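(* For every instance $I=(N,O,U)$ with additive utilities whose items are arranged on a path $(o_1,o_2,\dots,o_m)$, a connected PROP1$_{outer}$ allocation exists and can be computed in polynomial time.
   Context: An instance is a triple $I=(N,O,U)$ where $N=\{1,\dots,n\}$ is a set of agents, $O=\{o_1,\dots,o_m\}$ is a finite set of indivisible items, and $U$ is an $n$-tuple of utility functions $u_i:2^O\to\mathbb{R}$. Write $u_i(o)=u_i(\{o\})$; utilities may be positive, zero or negative, and the same item may have different signs for different agents. Utilities are additive: $u_i(X)=\sum_{o\in X}u_i(o)$ for every $X\subseteq O$. An allocation is a function $\pi:N\to 2^O$ with $\bigcup_{i\in N}\pi(i)=O$ and $\pi(i)\cap\pi(j)=\emptyset$ for distinct $i,j$. The items are placed on a path in the order $(o_1,o_2,\dots,o_m)$; a set of items is connected if it is a (possibly empty) set of consecutive items in this order. An allocation $\pi$ is connected if $\pi(i)$ is connected for each $i\in N$. A connected allocation $\pi$ is PROP1$_{outer}$ if for each agent $i\in N$ at least one of the following holds: (1) $u_i(\pi(i))\ge u_i(O)/n$; (2) $u_i(\pi(i))+u_i(o)\ge u_i(O)/n$ for some item $o\in O\setminus\pi(i)$ such that $\pi(i)\cup\{o\}$ is connected; (3) $u_i(\pi(i))-u_i(o)\ge u_i(O)/n$ for some $o\in\pi(i)$ such that $\pi(i)\setminus\{o\}$ is connected. Polynomial time is with respect to the input consisting of the path and the values $u_i(o_j)$. *)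

theory Defs
  imports
    Complex_Main
    "HOL-Library.Disjoint_Sets"
    "HOL-Library.Log_Nat"
    "HOL-Computational_Algebra.Polynomial"
begin

text \<open>
  The agents are \<open>{1..n}\<close>. The item in position \<open>j\<close> of the path is identified with its
  index, so the set of items is \<open>{1..m}\<close> and the path order is the order of the numbers.
  The utility of agent \<open>i\<close> is the set function \<open>u i\<close>; its values outside the subsets of
  \<open>{1..m}\<close>, and \<open>u i\<close> and \<open>\<pi> i\<close> for \<open>i \<notin> {1..n}\<close>, are irrelevant.
\<close>

definition additive_utilities :: "nat \<Rightarrow> nat \<Rightarrow> (nat \<Rightarrow> nat set \<Rightarrow> real) \<Rightarrow> bool" where
  "additive_utilities n m u \<longleftrightarrow>
     (\<forall>i\<in>{1..n}. \<forall>X. X \<subseteq> {1..m} \<longrightarrow> u i X = (\<Sum>j\<in>X. u i {j}))"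

definition allocation :: "nat \<Rightarrow> nat \<Rightarrow> (nat \<Rightarrow> nat set) \<Rightarrow> bool" where
  "allocation n m \<pi> \<longleftrightarrow> (\<Union>i\<in>{1..n}. \<pi> i) = {1..m} \<and> disjoint_family_on \<pi> {1..n}"

text \<open>The empty set is connected, as \<open>{a..b}\<close> is empty for \<open>b < a\<close>.\<close>

definition connected_items :: "nat \<Rightarrow> nat set \<Rightarrow> bool" where
  "connected_items m X \<longleftrightarrow> X \<subseteq> {1..m} \<and> (\<exists>a b. X = {a..b})"

definition connected_allocation :: "nat \<Rightarrow> nat \<Rightarrow> (nat \<Rightarrow> nat set) \<Rightarrow> bool" where
  "connected_allocation n m \<pi> \<longleftrightarrow>
     allocation n m \<pi> \<and> (\<forall>i\<in>{1..n}. connected_items m (\<pi> i))"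

definition PROP1_outer ::
  "nat \<Rightarrow> nat \<Rightarrow> (nat \<Rightarrow> nat set \<Rightarrow> real) \<Rightarrow> (nat \<Rightarrow> nat set) \<Rightarrow> bool" where
  "PROP1_outer n m u \<pi> \<longleftrightarrow>
     (\<forall>i\<in>{1..n}.
        u i (\<pi> i) \<ge> u i {1..m} / real n \<or>
        (\<exists>x\<in>{1..m} - \<pi> i. connected_items m (\<pi> i \<union> {x}) \<and>
            u i (\<pi> i) + u i {x} \<ge> u i {1..m} / real n) \<or>
        (\<exists>x\<in>\<pi> i. connected_items m (\<pi> i - {x}) \<and>
            u i (\<pi> i) - u i {x} \<ge> u i {1..m} / real n))"


text \<open>
  Polynomial time refers to structured programs of a random access machine under the
  logarithmic cost criterion: every operation is charged the bit lengths of the addresses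
  and of the values it uses, so that polynomial time on this machine is polynomial time on
  Turing machines, although multiplication is a primitive operation. A state consists of the
  registers, the unread input and the output produced so far; \<open>Read\<close> on exhausted input
  has no successor state. A negative value used as an address denotes register \<open>0\<close>.
\<close>

datatype com =
    Skip
  | Const nat int
  | Add nat nat nat
  | Sub nat nat nat
  | Mul nat nat nat
  | Load nat nat
  | Store nat nat
  | Read nat
  | Print nat
  | Seq com com
  | IfPos nat com com
  | WhilePos nat com

type_synonym state = "(nat \<Rightarrow> int) \<times> int list \<times> int list"

definition bits :: "int \<Rightarrow> nat" where
  "bits z = floorlog 2 (nat \<bar>z\<bar>) + 1"

inductive exec :: "com \<Rightarrow> state \<Rightarrow> nat \<Rightarrow> state \<Rightarrow> bool" where
  Skip: "exec Skip (s, xs, ys) 1 (s, xs, ys)"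
| Const: "exec (Const a z) (s, xs, ys) (bits (int a) + bits z) (s(a := z), xs, ys)"
| Add: "exec (Add a b c) (s, xs, ys)
    (bits (int a) + bits (int b) + bits (int c) + bits (s b) + bits (s c))
    (s(a := s b + s c), xs, ys)"
| Sub: "exec (Sub a b c) (s, xs, ys)
    (bits (int a) + bits (int b) + bits (int c) + bits (s b) + bits (s c))
    (s(a := s b - s c), xs, ys)"
| Mul: "exec (Mul a b c) (s, xs, ys)
    (bits (int a) + bits (int b) + bits (int c) + bits (s b) + bits (s c))
    (s(a := s b * s c), xs, ys)"
| Load: "exec (Load a b) (s, xs, ys)
    (bits (int a) + bits (int b) + bits (s b) + bits (s (nat (s b))))
    (s(a := s (nat (s b))), xs, ys)"
| Store: "exec (Store a b) (s, xs, ys)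
    (bits (int a) + bits (int b) + bits (s a) + bits (s b))
    (s(nat (s a) := s b), xs, ys)"
| Read: "exec (Read a) (s, x # xs, ys) (bits (int a) + bits x) (s(a := x), xs, ys)"
| Print: "exec (Print a) (s, xs, ys) (bits (int a) + bits (s a)) (s, xs, ys @ [s a])"
| Seq: "exec c1 st1 t1 st2 \<Longrightarrow> exec c2 st2 t2 st3 \<Longrightarrow> exec (Seq c1 c2) st1 (t1 + t2) st3"
| IfPos_True: "s a > 0 \<Longrightarrow> exec c1 (s, xs, ys) t st \<Longrightarrow>
    exec (IfPos a c1 c2) (s, xs, ys) (bits (int a) + bits (s a) + t) st"
| IfPos_False: "s a \<le> 0 \<Longrightarrow> exec c2 (s, xs, ys) t st \<Longrightarrow>
    exec (IfPos a c1 c2) (s, xs, ys) (bits (int a) + bits (s a) + t) st"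
| WhilePos_True: "s a > 0 \<Longrightarrow> exec c (s, xs, ys) t1 st1 \<Longrightarrow>
    exec (WhilePos a c) st1 t2 st2 \<Longrightarrow>
    exec (WhilePos a c) (s, xs, ys) (bits (int a) + bits (s a) + t1 + t2) st2"
| WhilePos_False: "s a \<le> 0 \<Longrightarrow>
    exec (WhilePos a c) (s, xs, ys) (bits (int a) + bits (s a)) (s, xs, ys)"

inductive_cases exec_elims:
  "exec Skip st t st'" "exec (Const a z) st t st'" "exec (Add a b c) st t st'"
  "exec (Sub a b c) st t st'" "exec (Mul a b c) st t st'" "exec (Load a b) st t st'"
  "exec (Store a b) st t st'" "exec (Read a) st t st'" "exec (Print a) st t st'"

inductive_cases exec_SeqE: "exec (Seq c1 c2) st t st'"
inductive_cases exec_IfPosE: "exec (IfPos a c1 c2) (s, xs, ys) t st'"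
inductive_cases exec_WhilePosE: "exec (WhilePos a c) (s, xs, ys) t st'"

text \<open>Execution is deterministic, so the existence of a run bounds the run.\<close>

lemma exec_deterministic:
  "exec c st t st' \<Longrightarrow> exec c st t2 st2 \<Longrightarrow> t2 = t \<and> st2 = st'"
proof (induction arbitrary: t2 st2 rule: exec.induct)
  case (Seq c1 st1 t1 st2 c2 t2 st3)
  from Seq.prems show ?case
    by (rule exec_SeqE) (metis Seq.IH)
next
  case (IfPos_True s a c1 xs ys t st c2)
  from IfPos_True.prems show ?case
    by (rule exec_IfPosE) (use IfPos_True.hyps in \<open>simp_all add: IfPos_True.IH\<close>)
next
  case (IfPos_False s a c2 xs ys t st c1)
  from IfPos_False.prems show ?case
    by (rule exec_IfPosE) (use IfPos_False.hyps in \<open>simp_all add: IfPos_False.IH\<close>)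
next
  case (WhilePos_True s a c xs ys t1 st1 t2 st2)
  from WhilePos_True.prems show ?case
    by (rule exec_WhilePosE) (metis WhilePos_True.IH, use WhilePos_True.hyps in simp)
next
  case (WhilePos_False s a c xs ys)
  from WhilePos_False.prems show ?case
    by (rule exec_WhilePosE) (use WhilePos_False.hyps in simp_all)
qed (erule exec_elims; simp)+

definition runs :: "com \<Rightarrow> int list \<Rightarrow> nat \<Rightarrow> int list \<Rightarrow> bool" where
  "runs P xs t ys \<longleftrightarrow> (\<exists>s xs'. exec P (\<lambda>_. 0, xs, []) t (s, xs', ys))"

definition input_size :: "int list \<Rightarrow> nat" where
  "input_size xs = sum_list (map bits xs)"

text \<open>
  The value of item \<open>j\<close> for agent \<open>i\<close> is given as the fraction \<open>num i j / den i j\<close>, not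
  necessarily in lowest terms; the values are listed agent by agent, along the path.
\<close>

definition instance_code ::
  "nat \<Rightarrow> nat \<Rightarrow> (nat \<Rightarrow> nat \<Rightarrow> int) \<Rightarrow> (nat \<Rightarrow> nat \<Rightarrow> int) \<Rightarrow> int list" where
  "instance_code n m num den =
     int n # int m #
     concat (map (\<lambda>i. concat (map (\<lambda>j. [num i j, den i j]) [1..<Suc m])) [1..<Suc n])"

text \<open>An output lists, along the path, the agents that receive the items.\<close>

definition decode_allocation :: "int list \<Rightarrow> nat \<Rightarrow> nat set" where
  "decode_allocation ys i = {j \<in> {1..length ys}. ys ! (j - 1) = int i}"

end

theory Submission
  imports Defs
begin

text \<open>
  Write \<open>S\<^sub>j(q)\<close> for the value of the first \<open>q\<close> items to agent \<open>j\<close>. The bundles are handed out from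
  left to right. In round \<open>r\<close> an agent \<open>j\<close> accepts a cut after item \<open>q\<close> if
  \<open>S\<^sub>j(q) \<ge> (r/n) S\<^sub>j(m)\<close>. As long as agents with a nonnegative total value are left, the
  leftmost acceptable cut wins, and the last of these agents receives all remaining items;
  otherwise the rightmost acceptable cut wins, and the bundle is empty if it is not right of the
  previous cut. The levels \<open>(r/n) S\<^sub>j(m)\<close> do not depend on the earlier rounds. In the first case
  the agents that are left had not reached level \<open>r - 1\<close> before the previous cut \<open>c\<close>, so the bundle
  of the winner together with item \<open>c\<close> is worth at least \<open>S\<^sub>j(m)/n\<close>. In the second case they are
  below level \<open>r - 1\<close> just after item \<open>c + 1\<close>, so the bundle without item \<open>c + 1\<close> is.

  For the running time, a register machine program with a bound on the number of iterations of
  each loop and on the length of all numbers involved has a cost that can be read off from its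
  syntax.
\<close>

subsection \<open>Handing out the bundles\<close>

text \<open>The condition of \<open>PROP1_outer\<close> for a single agent and bundle, so that it
  can be recorded for each agent as soon as the agent is served.\<close>

definition fair_share :: "nat \<Rightarrow> nat \<Rightarrow> (nat \<Rightarrow> nat set \<Rightarrow> real) \<Rightarrow> nat \<Rightarrow> nat set \<Rightarrow> bool" where
  "fair_share n m u i X \<longleftrightarrow>
     u i X \<ge> u i {1..m} / real n \<or>
     (\<exists>x\<in>{1..m} - X. connected_items m (X \<union> {x}) \<and> u i X + u i {x} \<ge> u i {1..m} / real n) \<or>
     (\<exists>x\<in>X. connected_items m (X - {x}) \<and> u i X - u i {x} \<ge> u i {1..m} / real n)"

text \<open>The comparison with the level is multiplied by \<open>n\<close>; after clearing
  denominators it becomes an integer test.\<close>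

definition reaches :: "nat \<Rightarrow> nat \<Rightarrow> (nat \<Rightarrow> nat set \<Rightarrow> real) \<Rightarrow> nat \<Rightarrow> nat \<Rightarrow> nat \<Rightarrow> bool" where
  "reaches n m u r j q \<longleftrightarrow> real r * u j {1..m} \<le> real n * u j {1..q}"

text \<open>
  Minimising the rank over all accepted cuts of all remaining agents selects the leftmost cut of an
  agent with nonnegative total value if there is one, and the rightmost cut otherwise.
\<close>

definition rank :: "nat \<Rightarrow> (nat \<Rightarrow> nat set \<Rightarrow> real) \<Rightarrow> nat \<Rightarrow> nat \<Rightarrow> nat" where
  "rank m u j q = (if 0 \<le> u j {1..m} then q else 2 * m + 1 - q)"

definition nonneg_agents :: "nat \<Rightarrow> nat \<Rightarrow> (nat \<Rightarrow> nat set \<Rightarrow> real) \<Rightarrow> nat set" where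
  "nonneg_agents n m u = {j \<in> {1..n}. 0 \<le> u j {1..m}}"

text \<open>The invariant after \<open>r\<close> rounds with served agents \<open>D\<close>; the
  current cut is \<open>length ys\<close>. The clause for negative totals leaves out
  \<open>r = 0\<close>: level 0 may be reached after the first item, and the first bundle, a prefix
  of the path, is handled directly.\<close>

definition progress ::
  "nat \<Rightarrow> nat \<Rightarrow> (nat \<Rightarrow> nat set \<Rightarrow> real) \<Rightarrow> nat \<Rightarrow> nat set \<Rightarrow> int list \<Rightarrow> bool" where
  "progress n m u r D ys \<longleftrightarrow>
     D \<subseteq> {1..n} \<and> card D = r \<and> length ys \<le> m \<and> set ys \<subseteq> int ` D \<and>
     (\<forall>i\<in>D. connected_items m (decode_allocation ys i) \<and>
        fair_share n m u i (decode_allocation ys i)) \<and>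
     (\<forall>j\<in>nonneg_agents n m u - D. \<forall>q<length ys. \<not> reaches n m u r j q) \<and>
     (nonneg_agents n m u \<subseteq> D \<longrightarrow> nonneg_agents n m u \<noteq> {} \<longrightarrow> length ys = m) \<and>
     (nonneg_agents n m u = {} \<longrightarrow> r \<noteq> 0 \<longrightarrow> length ys < m \<longrightarrow>
        (\<forall>j\<in>{1..n} - D. \<not> reaches n m u r j (Suc (length ys)))) \<and>
     (r = n \<longrightarrow> length ys = m)"

definition best_move ::
  "nat \<Rightarrow> nat \<Rightarrow> (nat \<Rightarrow> nat set \<Rightarrow> real) \<Rightarrow> nat \<Rightarrow> nat set \<Rightarrow> nat \<Rightarrow> nat \<Rightarrow> bool" where
  "best_move n m u r D i q \<longleftrightarrow>
     i \<in> {1..n} - D \<and> q \<le> m \<and> reaches n m u (Suc r) i q \<and>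
     (\<forall>j\<in>{1..n} - D. \<forall>q'\<le>m. reaches n m u (Suc r) j q' \<longrightarrow> rank m u i q \<le> rank m u j q')"

section \<open>Values of segments and decoding of outputs\<close>

lemma additive_segment:
  assumes "additive_utilities n m u" "i \<in> {1..n}" "a \<le> b" "b \<le> m"
  shows "u i {Suc a..b} = u i {1..b} - u i {1..a}"
proof -
  have *: "u i X = (\<Sum>j\<in>X. u i {j})" if "X \<subseteq> {1..m}" for X
    using assms(1,2) that by (auto simp: additive_utilities_def)
  have split: "{1..b} = {1..a} \<union> {Suc a..b}"
    using assms by auto
  have "(\<Sum>j\<in>{1..b}. u i {j}) = (\<Sum>j\<in>{1..a}. u i {j}) + (\<Sum>j\<in>{Suc a..b}. u i {j})"
    unfolding split by (rule sum.union_disjoint) auto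
  then show ?thesis
    using *[of "{1..b}"] *[of "{1..a}"] *[of "{Suc a..b}"] assms by auto
qed

lemma additive_empty:
  assumes "additive_utilities n m u" "i \<in> {1..n}"
  shows "u i {} = 0"
  using assms unfolding additive_utilities_def by (metis empty_subsetI sum.empty)

lemma nth_append_replicate:
  assumes "1 \<le> j" "j \<le> length ys + k"
  shows "(ys @ replicate k x) ! (j - 1) = (if j \<le> length ys then ys ! (j - 1) else x)"
proof (cases "j \<le> length ys")
  case False
  then have "j - 1 - length ys < k" "\<not> j - 1 < length ys" using assms by linarith+
  then show ?thesis using False by (simp add: nth_append)
qed (use assms in \<open>auto simp: nth_append\<close>)

lemma decode_append_other:
  assumes "i \<noteq> i'"
  shows "decode_allocation (ys @ replicate k (int i)) i' = decode_allocation ys i'"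
  using assms unfolding decode_allocation_def
  by (auto simp: nth_append_replicate[unfolded One_nat_def] split: if_splits)

lemma decode_append_new:
  assumes "int i \<notin> set ys"
  shows "decode_allocation (ys @ replicate k (int i)) i = {Suc (length ys)..length ys + k}"
proof -
  have "ys ! (j - 1) \<noteq> int i" if "1 \<le> j" "j \<le> length ys" for j
    using assms that nth_mem[of "j - 1" ys] by fastforce
  then show ?thesis
    unfolding decode_allocation_def
    by (auto simp: nth_append_replicate[unfolded One_nat_def] split: if_splits)
qed

section \<open>The invariant through the rounds\<close>

lemma progress_init:
  assumes "n \<ge> 1"
  shows "progress n m u 0 {} []"
  using assms unfolding progress_def by auto

text \<open>As \<open>card D = n\<close>, every agent is served, and an output of length
  \<open>m\<close> that names only served agents covers the path.\<close>

lemma progress_final: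
  assumes "progress n m u n D ys"
  shows "length ys = m" "connected_allocation n m (decode_allocation ys)"
    "PROP1_outer n m u (decode_allocation ys)"
proof -
  from assms have D: "D = {1..n}"
    by (intro card_subset_eq) (auto simp: progress_def)
  from assms show len: "length ys = m"
    by (simp add: progress_def)
  have cover: "\<exists>i\<in>{1..n}. j \<in> decode_allocation ys i" if "j \<in> {1..m}" for j
  proof -
    have "ys ! (j - 1) \<in> set ys" using that len by (intro nth_mem) auto
    then have "ys ! (j - 1) \<in> int ` {1..n}"
      using assms D unfolding progress_def by blast
    then show ?thesis using that len by (auto simp: decode_allocation_def)
  qed
  have sub: "decode_allocation ys i \<subseteq> {1..m}" for i
    using len by (auto simp: decode_allocation_def)
  have "allocation n m (decode_allocation ys)"
    unfolding allocation_def
  proof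
    show "(\<Union>i\<in>{1..n}. decode_allocation ys i) = {1..m}"
      using cover sub by blast
  qed (auto simp: disjoint_family_on_def decode_allocation_def)
  then show "connected_allocation n m (decode_allocation ys)"
    using assms D by (auto simp: connected_allocation_def progress_def)
  show "PROP1_outer n m u (decode_allocation ys)"
    using assms D unfolding PROP1_outer_def progress_def fair_share_def by blast
qed

lemma reaches_end:
  assumes "0 \<le> u j {1..m}" "r \<le> n"
  shows "reaches n m u r j m"
  using assms by (simp add: reaches_def mult_right_mono)

text \<open>Every unserved agent accepts some cut: the end of the path if the total is nonnegative,
  and cut 0 if it is negative, since then the level is negative and the empty prefix is worth 0.
  Among finitely many moves some rank is minimal.\<close>

lemma best_move_exists:
  assumes "additive_utilities n m u" "progress n m u r D ys" "r < n"
  shows "\<exists>i q. best_move n m u r D i q"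
proof -
  define V where "V = {(j, q). j \<in> {1..n} - D \<and> q \<le> m \<and> reaches n m u (Suc r) j q}"
  have "D \<noteq> {1..n}" "D \<subseteq> {1..n}"
    using assms by (auto simp: progress_def)
  then obtain j where j: "j \<in> {1..n} - D" by blast
  have "(j, if 0 \<le> u j {1..m} then m else 0) \<in> V"
    using j assms additive_empty[of n m u j] reaches_end[of u j m "Suc r" n]
    by (auto simp: V_def reaches_def mult_nonneg_nonpos)
  then have ne: "V \<noteq> {}" by auto
  have "finite V"
    by (rule finite_subset[of _ "{1..n} \<times> {..m}"]) (auto simp: V_def)
  then have "\<exists>x. is_arg_min (\<lambda>x. rank m u (fst x) (snd x)) (\<lambda>x. x \<in> V) x"
    using ex_is_arg_min_if_finite ne by blast
  then obtain x where "x \<in> V" "\<forall>y\<in>V. rank m u (fst x) (snd x) \<le> rank m u (fst y) (snd y)"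
    by (auto simp: is_arg_min_linorder)
  then have "best_move n m u r D (fst x) (snd x)"
    unfolding best_move_def V_def by (auto split: prod.splits)
  then show ?thesis by blast
qed

text \<open>The winner's prefix up to \<open>q2\<close> has reached level \<open>Suc r\<close>,
  while the invariant bounds a prefix next to the old cut by level \<open>r\<close>; the difference
  is one share. Truncated subtraction makes the bundle empty when \<open>q2\<close> is not right of
  the old cut.\<close>

lemma progress_step:
  assumes add: "additive_utilities n m u" and pr: "progress n m u r D ys" and "r < n"
    and best: "best_move n m u r D i q"
    and q2: "q2 = (if card (nonneg_agents n m u - D) = 1 then m else q)"
  shows "progress n m u (Suc r) (insert i D) (ys @ replicate (q2 - length ys) (int i))"
proof -
  let ?c = "length ys" and ?P = "nonneg_agents n m u"
  define c' where "c' = max ?c q2"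
  define X where "X = {Suc ?c..c'}"
  have i: "i \<in> {1..n}" "i \<notin> D" and qm: "q \<le> m" and rq: "reaches n m u (Suc r) i q"
    and min: "\<And>j q'. j \<in> {1..n} - D \<Longrightarrow> q' \<le> m \<Longrightarrow> reaches n m u (Suc r) j q' \<Longrightarrow>
      rank m u i q \<le> rank m u j q'"
    using best by (auto simp: best_move_def)
  have D: "D \<subseteq> {1..n}" "card D = r" "?c \<le> m" "set ys \<subseteq> int ` D"
    using pr unfolding progress_def by blast+
  then have finD: "finite D" using finite_subset by blast
  have served: "\<And>j. j \<in> D \<Longrightarrow> connected_items m (decode_allocation ys j) \<and>
      fair_share n m u j (decode_allocation ys j)"
    and low: "\<And>j q'. j \<in> ?P - D \<Longrightarrow> q' < ?c \<Longrightarrow> \<not> reaches n m u r j q'"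
    and full: "?P \<subseteq> D \<Longrightarrow> ?P \<noteq> {} \<Longrightarrow> ?c = m"
    and high: "\<And>j. ?P = {} \<Longrightarrow> r \<noteq> 0 \<Longrightarrow> ?c < m \<Longrightarrow> j \<in> {1..n} - D \<Longrightarrow>
      \<not> reaches n m u r j (Suc ?c)"
    using pr unfolding progress_def by blast+
  have n0: "real n > 0" using \<open>r < n\<close> by simp
  have c': "?c \<le> c'" "c' \<le> m" "?c + (q2 - ?c) = c'"
    using D qm q2 by (auto simp: c'_def)
  have inew: "int i \<notin> set ys" using D i by auto
  have dec_i: "decode_allocation (ys @ replicate (q2 - ?c) (int i)) i = X"
    using decode_append_new[OF inew] c' by (simp add: X_def)
  have seg: "u i {Suc a..b} = u i {1..b} - u i {1..a}" if "a \<le> b" "b \<le> m" for a b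
    using additive_segment[OF add i(1)] that by blast
  have emp: "u i {} = 0" using additive_empty[OF add i(1)] .
  \<comment> \<open>With a nonnegative total the levels grow from round to round.\<close>
  have mono: "reaches n m u r j q'" if "j \<in> ?P" "reaches n m u (Suc r) j q'" for j q'
    using that mult_right_mono[of "real r" "real (Suc r)" "u j {1..m}"]
    by (auto simp: reaches_def nonneg_agents_def)
  \<comment> \<open>Nonnegative totals give ranks at most \<open>m\<close>, negative totals ranks at
    least \<open>m + 1\<close>, and an agent with nonnegative total always accepts cut
    \<open>m\<close>.\<close>
  have pos_rank: "i \<in> ?P" if "j \<in> ?P - D" for j
  proof -
    have "rank m u i q \<le> rank m u j m"
      using min[of j m] that reaches_end[of u j m "Suc r" n] \<open>r < n\<close>
      by (auto simp: nonneg_agents_def)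
    then show ?thesis
      using that i qm by (auto simp: rank_def nonneg_agents_def split: if_splits)
  qed
  have first: "\<not> reaches n m u (Suc r) j q'" if "j \<in> ?P - D" "q' < q" for j q'
    using min[of j q'] that pos_rank[OF that(1)] qm
    by (auto simp: rank_def nonneg_agents_def)
  have last: "\<not> reaches n m u (Suc r) j q'" if "?P = {}" "j \<in> {1..n} - D" "q < q'" "q' \<le> m" for j q'
    using min[of j q'] that i
    by (auto simp: rank_def nonneg_agents_def)
  have rq2: "reaches n m u (Suc r) i q2" if "i \<in> ?P"
    using q2 rq reaches_end[of u i m "Suc r" n] that \<open>r < n\<close>
    by (auto simp: nonneg_agents_def)
  have neg_empty: "fair_share n m u i {}" if "i \<notin> ?P"
    using that emp i n0 by (auto simp: fair_share_def nonneg_agents_def divide_le_0_iff)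
  have conn: "connected_items m X"
    using c' by (auto simp: connected_items_def X_def)
  \<comment> \<open>A cut left of \<open>?c\<close> that reaches level \<open>Suc r\<close> would
    also reach level \<open>r\<close>, against the invariant.\<close>
  have c'_q2: "c' = q2" if "i \<in> ?P"
  proof -
    have "\<not> q < ?c" using low[of i q] mono[of i q] that i rq by blast
    then have "?c \<le> q2" using q2 D by auto
    then show ?thesis by (simp add: c'_def)
  qed
  have fair: "fair_share n m u i X"
  proof (cases "i \<in> ?P")
    case True
    then have T: "u i {1..m} \<ge> 0" by (simp add: nonneg_agents_def)
    have [simp]: "c' = q2" using c'_q2[OF True] .
    then have "?c \<le> q2" using c' by simp
    have q2m: "q2 \<le> m" using c' by simp
    have up: "real (Suc r) * u i {1..m} \<le> real n * u i {1..q2}"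
      using rq2[OF True] by (simp add: reaches_def)
    show ?thesis
    proof (cases "?c = 0")
      case True
      \<comment> \<open>Nothing has been handed out, so the bundle is a whole prefix;
        \<open>Suc r\<close> shares of a nonnegative total are at least one share.\<close>
      have "u i {1..m} \<le> real (Suc r) * u i {1..m}"
        using T by (simp add: mult_le_cancel_right1)
      with up have "u i {1..m} \<le> real n * u i {1..q2}" by linarith
      then have "u i {1..m} / real n \<le> u i X"
        using n0 True by (simp add: X_def divide_le_eq mult.commute)
      then show ?thesis by (simp add: fair_share_def)
    next
      case False
      then have cpos: "?c \<ge> 1" by linarith
      \<comment> \<open>The invariant at the cut just before item \<open>?c\<close>. Subtracted from
        \<open>up\<close>, it leaves one share for the bundle enlarged by that item.\<close>
      have lo: "real n * u i {1..?c - 1} \<le> real r * u i {1..m}"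
      proof -
        have "?c - 1 < ?c" using cpos by linarith
        then have "\<not> reaches n m u r i (?c - 1)"
          using low \<open>i \<in> ?P\<close> i by blast
        then show ?thesis unfolding reaches_def by linarith
      qed
      have Suc_c: "Suc (?c - 1) = ?c" using cpos by linarith
      have "X \<union> {?c} = {?c..q2}"
        using cpos \<open>?c \<le> q2\<close> by (auto simp: X_def)
      have s1: "u i X = u i {1..q2} - u i {1..?c}"
        using seg[of ?c q2] \<open>?c \<le> q2\<close> q2m by (simp add: X_def)
      have s2: "u i {?c} = u i {1..?c} - u i {1..?c - 1}"
        using seg[of "?c - 1" ?c] D unfolding Suc_c by simp
      have "u i {1..m} \<le> real n * (u i X + u i {?c})"
      proof -
        have "u i X + u i {?c} = u i {1..q2} - u i {1..?c - 1}" using s1 s2 by linarith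
        then show ?thesis using up lo by (simp add: right_diff_distrib distrib_right)
      qed
      then have "u i {1..m} / real n \<le> u i X + u i {?c}"
        using n0 by (simp add: divide_le_eq mult.commute)
      moreover have "connected_items m (X \<union> {?c})"
        unfolding \<open>X \<union> {?c} = _\<close> connected_items_def using q2m cpos by auto
      moreover have "?c \<in> {1..m} - X" using cpos D by (auto simp: X_def)
      ultimately show ?thesis unfolding fair_share_def by blast
    qed
  next
    case False
    then have sub: "?P \<subseteq> D" using pos_rank by blast
    then have q2q: "q2 = q" using q2 by (auto simp: Diff_eq_empty_iff[THEN iffD2])
    show ?thesis
    proof (cases "?P = {} \<and> ?c < q")
      case nF: False
      \<comment> \<open>If there were agents with nonnegative total, all are served and no item is
        left; otherwise the new cut is not right of the old one. The bundle is empty either way,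
        which is fair for a negative total.\<close>
      have "\<not> ?c < q" using nF full[OF sub] qm by (cases "?P = {}") simp_all
      then have "X = {}" using q2q by (simp add: X_def c'_def)
      then show ?thesis using neg_empty[OF False] by simp
    next
      case True
      then have [simp]: "c' = q" using q2q by (simp add: c'_def)
      have up: "real (Suc r) * u i {1..m} \<le> real n * u i {1..q}"
        using rq by (simp add: reaches_def)
      show ?thesis
      proof (cases "r = 0")
        case r0: True
        then have "ys = []" using D finD by auto
        then have "u i {1..m} / real n \<le> u i X"
          using up n0 r0 by (simp add: X_def divide_le_eq mult.commute)
        then show ?thesis by (simp add: fair_share_def)
      next
        case r0: False
        \<comment> \<open>The invariant one item past the old cut. Subtracted from
          \<open>up\<close>, it leaves one share for the bundle without item
          \<open>Suc ?c\<close>.\<close>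
        have lo: "real n * u i {1..Suc ?c} \<le> real r * u i {1..m}"
          using high[of i] True r0 i qm by (auto simp: reaches_def)
        have s1: "u i X = u i {1..q} - u i {1..?c}"
          using seg[of ?c q] True qm by (simp add: X_def)
        have s2: "u i {Suc ?c} = u i {1..Suc ?c} - u i {1..?c}"
          using seg[of "?c" "Suc ?c"] True qm by simp
        have "u i {1..m} \<le> real n * (u i X - u i {Suc ?c})"
        proof -
          have "u i X - u i {Suc ?c} = u i {1..q} - u i {1..Suc ?c}" using s1 s2 by linarith
          then show ?thesis using up lo by (simp add: right_diff_distrib distrib_right)
        qed
        then have "u i {1..m} / real n \<le> u i X - u i {Suc ?c}"
          using n0 by (simp add: divide_le_eq mult.commute)
        moreover have "X - {Suc ?c} = {Suc (Suc ?c)..q}" by (auto simp: X_def)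
        then have "connected_items m (X - {Suc ?c})"
          unfolding connected_items_def using qm by auto
        moreover have "Suc ?c \<in> X" using True by (simp add: X_def)
        ultimately show ?thesis unfolding fair_share_def by blast
      qed
    qed
  qed
  have A: "\<forall>j\<in>insert i D.
      connected_items m (decode_allocation (ys @ replicate (q2 - ?c) (int i)) j) \<and>
      fair_share n m u j (decode_allocation (ys @ replicate (q2 - ?c) (int i)) j)"
  proof
    fix j assume "j \<in> insert i D"
    then consider "j = i" | "j \<in> D" "j \<noteq> i" by blast
    then show "connected_items m (decode_allocation (ys @ replicate (q2 - ?c) (int i)) j) \<and>
      fair_share n m u j (decode_allocation (ys @ replicate (q2 - ?c) (int i)) j)"
    proof cases
      case 1
      then show ?thesis using dec_i conn fair by simp
    next
      case 2
      then show ?thesis using served[of j] decode_append_other[of i j] by simp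
    qed
  qed
  have c'_m: "c' = m" if "?P \<subseteq> insert i D" "?P \<noteq> {}"
  proof (cases "?P \<subseteq> D")
    case True
    then show ?thesis using full that c' by auto
  next
    case False
    then have "?P - D = {i}" using that by auto
    then have "q2 = m" using q2 by simp
    then show ?thesis using D by (simp add: c'_def)
  qed
  \<comment> \<open>A further unserved agent with nonnegative total shows that the winner is not the
    last one, so the bundle ends at \<open>q\<close>, the leftmost accepted cut.\<close>
  have B: "\<forall>j\<in>?P - insert i D. \<forall>q'<c'. \<not> reaches n m u (Suc r) j q'"
  proof (intro ballI allI impI)
    fix j q' assume j: "j \<in> ?P - insert i D" and q': "q' < c'"
    have iP: "i \<in> ?P" using pos_rank j by auto
    have "{i, j} \<subseteq> ?P - D" "i \<noteq> j" using iP i j by auto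
    then have "card (?P - D) \<noteq> 1"
      by (metis card_1_singletonE insert_subset singletonD)
    then have "q2 = q" using q2 by simp
    then show "\<not> reaches n m u (Suc r) j q'"
      using first[of j q'] j q' c'_q2[OF iP] by auto
  qed
  \<comment> \<open>Every remaining agent rejected all cuts right of \<open>q\<close>, and
    \<open>c'\<close> is at least \<open>q\<close>.\<close>
  have C: "\<not> reaches n m u (Suc r) j (Suc c')" if "?P = {}" "c' < m" "j \<in> {1..n} - insert i D" for j
  proof (rule last)
    show "q < Suc c'" using q2 that(1) by (simp add: c'_def)
  qed (use that in auto)
  have E: "c' = m" if "Suc r = n"
  proof (cases "?P = {}")
    case True
    \<comment> \<open>Level \<open>n\<close> is the total value, so the winner accepts cut
      \<open>m\<close>, and the rightmost accepted cut is the end.\<close>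
    have "reaches n m u (Suc r) i m" using that by (simp add: reaches_def)
    then have "\<not> q < m" using last[of i m] True i by auto
    then show ?thesis using True q2 qm c' by (auto simp: c'_def)
  next
    case False
    have "card (insert i D) = n" using D finD i that by simp
    then have "insert i D = {1..n}" using D i
      by (intro card_subset_eq) auto
    moreover have "?P \<subseteq> {1..n}" by (auto simp: nonneg_agents_def)
    ultimately show ?thesis using c'_m False by simp
  qed
  have len: "length (ys @ replicate (q2 - ?c) (int i)) = c'"
    using c' by simp
  have sub: "set (ys @ replicate (q2 - ?c) (int i)) \<subseteq> int ` insert i D"
    using D by auto
  have ins: "insert i D \<subseteq> {1..n}" "card (insert i D) = Suc r" using D finD i by auto
  show ?thesis
    unfolding progress_def len
  proof (intro conjI)
    show "?P = {} \<longrightarrow> Suc r \<noteq> 0 \<longrightarrow> c' < m \<longrightarrow>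
        (\<forall>j\<in>{1..n} - insert i D. \<not> reaches n m u (Suc r) j (Suc c'))"
      using C by blast
    show "?P \<subseteq> insert i D \<longrightarrow> ?P \<noteq> {} \<longrightarrow> c' = m" using c'_m by blast
    show "Suc r = n \<longrightarrow> c' = m" using E by blast
  qed (fact sub ins A B c')+
qed

lemma progress_exists:
  assumes "additive_utilities n m u" "n \<ge> 1" "r \<le> n"
  shows "\<exists>D ys. progress n m u r D ys"
  using assms(3)
proof (induction r)
  case 0
  then show ?case using progress_init[OF assms(2)] by blast
next
  case (Suc r)
  then obtain D ys where "progress n m u r D ys" by auto
  moreover have "r < n" using Suc.prems by simp
  moreover obtain i q where "best_move n m u r D i q"
    using best_move_exists[OF assms(1)] calculation by blast
  ultimately show ?case
    using progress_step[OF assms(1)] by blast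
qed

subsection \<open>Cost of programs\<close>

text \<open>A common bound on the bit length of addresses and contents; \<open>L\<close> will be the
  input size. The longest numbers, in the level test, have about \<open>3 * L\<close> bits.\<close>

definition width :: "nat \<Rightarrow> nat" where
  "width L = 6 * L + 100"

lemma bits_le_iff: "bits z \<le> Suc k \<longleftrightarrow> \<bar>z\<bar> < 2 ^ k"
proof -
  have "floorlog 2 (nat \<bar>z\<bar>) \<le> k \<longleftrightarrow> nat \<bar>z\<bar> < 2 ^ k"
    by (simp add: floorlog_le_iff)
  also have "\<dots> \<longleftrightarrow> \<bar>z\<bar> < 2 ^ k"
    by (metis nat_less_numeral_power_cancel_iff)
  finally show ?thesis by (simp add: bits_def)
qed

text \<open>By \<open>k < 2 ^ k\<close>; this crude bound is enough for counters and
  addresses.\<close>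

lemma bits_le_abs: "\<bar>z\<bar> \<le> int k \<Longrightarrow> bits z \<le> Suc k"
  unfolding bits_le_iff by (metis le_less_trans of_nat_less_two_power)

lemma bits_pos: "0 < bits z"
  by (simp add: bits_def)

lemma abs_less_bits: "\<bar>z\<bar> < 2 ^ (bits z - 1)"
  using bits_le_iff[of z "bits z - 1"] bits_pos[of z] by simp

lemma bits_mult: "bits (x * y) \<le> bits x + bits y"
proof -
  obtain k l where k: "bits x = Suc k" "bits y = Suc l"
    using bits_pos by (metis Suc_pred')
  then have "\<bar>x\<bar> * \<bar>y\<bar> < 2 ^ k * 2 ^ l"
    using bits_le_iff[of x k] bits_le_iff[of y l] by (intro mult_strict_mono') auto
  then have "bits (x * y) \<le> Suc (k + l)"
    by (simp add: bits_le_iff abs_mult power_add)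
  then show ?thesis using k by simp
qed

lemma bits_add: "bits (x + y) \<le> Suc (max (bits x) (bits y))"
proof -
  obtain k where k: "max (bits x) (bits y) = Suc k"
    using bits_pos by (metis Suc_pred' less_max_iff_disj)
  then have "\<bar>x\<bar> < 2 ^ k" "\<bar>y\<bar> < 2 ^ k"
    by (metis bits_le_iff max.cobounded1, metis bits_le_iff max.cobounded2 k)
  then have "\<bar>x + y\<bar> < 2 ^ Suc k" by simp
  then show ?thesis by (simp only: bits_le_iff k)
qed

lemma bits_uminus [simp]: "bits (- x) = bits x"
  by (simp add: bits_def)

lemma bits_diff: "bits (x - y) \<le> Suc (max (bits x) (bits y))"
  using bits_add[of x "- y"] by simp

text \<open>Every operation costs at most five numbers of the given width, every loop runs at most \<open>L + 1\<close> times.\<close>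

fun cost :: "nat \<Rightarrow> com \<Rightarrow> nat" where
  "cost L (Seq c1 c2) = cost L c1 + cost L c2"
| "cost L (IfPos a c1 c2) = 5 * width L + cost L c1 + cost L c2"
| "cost L (WhilePos a c) = Suc L * (5 * width L + cost L c) + 5 * width L"
| "cost L c = 5 * width L"

text \<open>The program is fixed, and \<open>L\<close> enters only through the linear width and the
  linear loop bound; nesting loops multiplies linear factors. The polynomial \<open>?w\<close> is
  \<open>5 * width L\<close>.\<close>

lemma cost_poly: "\<exists>p :: nat poly. \<forall>L. cost L c = poly p L"
proof -
  let ?w = "[:500, 30:] :: nat poly"
  have w: "5 * width L = poly ?w L" for L by (simp add: width_def)
  have atomic: "\<exists>p :: nat poly. \<forall>L. 5 * width L = poly p L" using w by blast
  show ?thesis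
  proof (induction c)
    case (Seq c1 c2)
    then obtain p1 p2 where "\<forall>L. cost L c1 = poly p1 L" "\<forall>L. cost L c2 = poly p2 L" by blast
    then have "\<forall>L. cost L (Seq c1 c2) = poly (p1 + p2) L" by simp
    then show ?case by blast
  next
    case (IfPos a c1 c2)
    then obtain p1 p2 where "\<forall>L. cost L c1 = poly p1 L" "\<forall>L. cost L c2 = poly p2 L" by blast
    then have "\<forall>L. cost L (IfPos a c1 c2) = poly (?w + p1 + p2) L"
      by (simp add: width_def)
    then show ?case by blast
  next
    case (WhilePos a c)
    then obtain p1 where "\<forall>L. cost L c = poly p1 L" by blast
    then have "\<forall>L. cost L (WhilePos a c) = poly ([:1, 1:] * (?w + p1) + ?w) L"
      by (simp add: width_def algebra_simps)
    then show ?case by blast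
  qed (use atomic in simp_all)
qed

text \<open>Total correctness with a time bound, so that termination, result and cost are
  established by the same proof rules.\<close>

definition wp :: "nat \<Rightarrow> com \<Rightarrow> (nat \<Rightarrow> int) \<Rightarrow> int list \<Rightarrow> int list \<Rightarrow>
    ((nat \<Rightarrow> int) \<Rightarrow> int list \<Rightarrow> int list \<Rightarrow> bool) \<Rightarrow> bool" where
  "wp L c s xs ys Q \<longleftrightarrow>
     (\<exists>t s' xs' ys'. exec c (s, xs, ys) t (s', xs', ys') \<and> t \<le> cost L c \<and> Q s' xs' ys')"

definition small :: "nat \<Rightarrow> int \<Rightarrow> bool" where
  "small L z \<longleftrightarrow> bits z \<le> width L"

lemma small_le: "\<bar>z\<bar> \<le> 6 * int L + 99 \<Longrightarrow> small L z"
  using bits_le_abs[of z "6 * L + 99"] by (simp add: small_def width_def)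

lemma small_reg: "a \<le> 99 \<Longrightarrow> small L (int a)"
  by (rule small_le) simp

section \<open>Proof rules for runs within the cost bound\<close>

lemma wp_conseq:
  assumes "wp L c s xs ys Q" "\<And>s xs ys. Q s xs ys \<Longrightarrow> Q' s xs ys"
  shows "wp L c s xs ys Q'"
  using assms unfolding wp_def by blast

lemma wp_Skip: "Q s xs ys \<Longrightarrow> wp L Skip s xs ys Q"
  unfolding wp_def by (intro exI conjI, rule exec.Skip) (simp_all add: width_def)

lemma wp_atomic:
  assumes "exec c (s, xs, ys) t (s', xs', ys')" "t \<le> 5 * width L" "cost L c = 5 * width L"
    "Q s' xs' ys'"
  shows "wp L c s xs ys Q"
  using assms unfolding wp_def by auto

lemma wp_Const:
  "a \<le> 99 \<Longrightarrow> small L z \<Longrightarrow> Q (s(a := z)) xs ys \<Longrightarrow> wp L (Const a z) s xs ys Q"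
  using small_reg[of a L] by (intro wp_atomic[OF exec.Const]) (auto simp: small_def)

lemma wp_Add:
  "a \<le> 99 \<Longrightarrow> b \<le> 99 \<Longrightarrow> c \<le> 99 \<Longrightarrow> small L (s b) \<Longrightarrow> small L (s c) \<Longrightarrow>
   Q (s(a := s b + s c)) xs ys \<Longrightarrow> wp L (Add a b c) s xs ys Q"
  using small_reg[of a L] small_reg[of b L] small_reg[of c L]
  by (intro wp_atomic[OF exec.Add]) (auto simp: small_def)

lemma wp_Sub:
  "a \<le> 99 \<Longrightarrow> b \<le> 99 \<Longrightarrow> c \<le> 99 \<Longrightarrow> small L (s b) \<Longrightarrow> small L (s c) \<Longrightarrow>
   Q (s(a := s b - s c)) xs ys \<Longrightarrow> wp L (Sub a b c) s xs ys Q"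
  using small_reg[of a L] small_reg[of b L] small_reg[of c L]
  by (intro wp_atomic[OF exec.Sub]) (auto simp: small_def)

lemma wp_Mul:
  "a \<le> 99 \<Longrightarrow> b \<le> 99 \<Longrightarrow> c \<le> 99 \<Longrightarrow> small L (s b) \<Longrightarrow> small L (s c) \<Longrightarrow>
   Q (s(a := s b * s c)) xs ys \<Longrightarrow> wp L (Mul a b c) s xs ys Q"
  using small_reg[of a L] small_reg[of b L] small_reg[of c L]
  by (intro wp_atomic[OF exec.Mul]) (auto simp: small_def)

lemma wp_Load:
  "a \<le> 99 \<Longrightarrow> b \<le> 99 \<Longrightarrow> small L (s b) \<Longrightarrow> small L (s (nat (s b))) \<Longrightarrow>
   Q (s(a := s (nat (s b)))) xs ys \<Longrightarrow> wp L (Load a b) s xs ys Q"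
  using small_reg[of a L] small_reg[of b L]
  by (intro wp_atomic[OF exec.Load]) (auto simp: small_def)

lemma wp_Store:
  "a \<le> 99 \<Longrightarrow> b \<le> 99 \<Longrightarrow> small L (s a) \<Longrightarrow> small L (s b) \<Longrightarrow>
   Q (s(nat (s a) := s b)) xs ys \<Longrightarrow> wp L (Store a b) s xs ys Q"
  using small_reg[of a L] small_reg[of b L]
  by (intro wp_atomic[OF exec.Store]) (auto simp: small_def)

lemma wp_Read:
  "a \<le> 99 \<Longrightarrow> xs \<noteq> [] \<Longrightarrow> small L (hd xs) \<Longrightarrow>
   Q (s(a := hd xs)) (tl xs) ys \<Longrightarrow> wp L (Read a) s xs ys Q"
  using small_reg[of a L] exec.Read[of a s "hd xs" "tl xs" ys]
  by (intro wp_atomic[where t = "bits (int a) + bits (hd xs)"]) (auto simp: small_def)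

lemma wp_Print:
  "a \<le> 99 \<Longrightarrow> small L (s a) \<Longrightarrow> Q s xs (ys @ [s a]) \<Longrightarrow> wp L (Print a) s xs ys Q"
  using small_reg[of a L]
  by (intro wp_atomic[OF exec.Print]) (auto simp: small_def)

lemma wp_Seq:
  assumes "wp L c1 s xs ys (\<lambda>s xs ys. wp L c2 s xs ys Q)"
  shows "wp L (Seq c1 c2) s xs ys Q"
proof -
  from assms obtain t1 s1 xs1 ys1 t2 s2 xs2 ys2 where
    "exec c1 (s, xs, ys) t1 (s1, xs1, ys1)" "t1 \<le> cost L c1"
    "exec c2 (s1, xs1, ys1) t2 (s2, xs2, ys2)" "t2 \<le> cost L c2" "Q s2 xs2 ys2"
    unfolding wp_def by blast
  then show ?thesis
    unfolding wp_def by (intro exI[of _ "t1 + t2"] exI conjI) (auto intro: exec.Seq)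
qed

lemma wp_IfPos:
  assumes "a \<le> 99" "small L (s a)" "s a > 0 \<Longrightarrow> wp L c1 s xs ys Q" "s a \<le> 0 \<Longrightarrow> wp L c2 s xs ys Q"
  shows "wp L (IfPos a c1 c2) s xs ys Q"
proof -
  have w: "bits (int a) + bits (s a) \<le> 5 * width L"
    using assms(2) small_reg[OF assms(1), of L] by (simp add: small_def)
  show ?thesis
  proof (cases "s a > 0")
    case True
    with assms(3) obtain t s' xs' ys' where
      "exec c1 (s, xs, ys) t (s', xs', ys')" "t \<le> cost L c1" "Q s' xs' ys'"
      unfolding wp_def by blast
    with True w show ?thesis
      unfolding wp_def
      by (intro exI[of _ "bits (int a) + bits (s a) + t"] exI conjI)
        (auto intro: exec.IfPos_True)
  next
    case False
    with assms(4) obtain t s' xs' ys' where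
      "exec c2 (s, xs, ys) t (s', xs', ys')" "t \<le> cost L c2" "Q s' xs' ys'"
      unfolding wp_def by (meson not_less)
    with False w show ?thesis
      unfolding wp_def
      by (intro exI[of _ "bits (int a) + bits (s a) + t"] exI conjI)
        (auto intro: exec.IfPos_False)
  qed
qed

text \<open>The invariant is indexed by the number of completed iterations and fixes the control
  register to \<open>N - i\<close>, so the loop ends after exactly \<open>N\<close> iterations. The
  proof is by induction on the number \<open>k\<close> of iterations still to come.\<close>

lemma wp_WhilePos:
  assumes init: "I 0 s xs ys" and N: "N \<le> Suc L" and a: "a \<le> 99"
    and counter: "\<And>i s xs ys. I i s xs ys \<Longrightarrow> i \<le> N \<Longrightarrow> s a = int (N - i)"
    and step: "\<And>i s xs ys. I i s xs ys \<Longrightarrow> i < N \<Longrightarrow> wp L c s xs ys (I (Suc i))"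
    and final: "\<And>s xs ys. I N s xs ys \<Longrightarrow> Q s xs ys"
  shows "wp L (WhilePos a c) s xs ys Q"
proof -
  have *: "\<exists>t s' xs' ys'. exec (WhilePos a c) (s, xs, ys) t (s', xs', ys') \<and>
      t \<le> k * (5 * width L + cost L c) + 5 * width L \<and> I N s' xs' ys'"
    if "I (N - k) s xs ys" "k \<le> N" for k s xs ys
    using that
  proof (induction k arbitrary: s xs ys)
    case 0
    then have sa: "s a = 0" using counter[of "N - 0" s xs ys] by simp
    have "bits (int a) + bits (s a) \<le> 5 * width L"
      using sa small_reg[OF a, of L] small_le[of 0 L] by (simp add: small_def)
    moreover have "exec (WhilePos a c) (s, xs, ys) (bits (int a) + bits (s a)) (s, xs, ys)"
      by (rule exec.WhilePos_False) (simp add: sa)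
    ultimately show ?case using 0 by auto
  next
    case (Suc k)
    then have sa: "s a = int (Suc k)" using counter[of "N - Suc k" s xs ys] by simp
    then have w: "bits (int a) + bits (s a) \<le> 5 * width L"
      using small_reg[OF a, of L] small_le[of "s a" L] N Suc.prems by (simp add: small_def)
    obtain t1 s1 xs1 ys1 where 1: "exec c (s, xs, ys) t1 (s1, xs1, ys1)" "t1 \<le> cost L c"
      "I (Suc (N - Suc k)) s1 xs1 ys1"
      using step[OF Suc.prems(1)] Suc.prems(2) unfolding wp_def by auto
    then have "I (N - k) s1 xs1 ys1" using Suc.prems by (simp add: Suc_diff_Suc)
    then obtain t2 s2 xs2 ys2 where 2: "exec (WhilePos a c) (s1, xs1, ys1) t2 (s2, xs2, ys2)"
      "t2 \<le> k * (5 * width L + cost L c) + 5 * width L" "I N s2 xs2 ys2"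
      using Suc.IH[of s1 xs1 ys1] Suc.prems by auto
    have "exec (WhilePos a c) (s, xs, ys) (bits (int a) + bits (s a) + t1 + t2) (s2, xs2, ys2)"
      by (rule exec.WhilePos_True[OF _ 1(1) 2(1)]) (simp add: sa)
    moreover have "bits (int a) + bits (s a) + t1 + t2
        \<le> Suc k * (5 * width L + cost L c) + 5 * width L"
      using w 1(2) 2(2) by simp
    ultimately show ?case using 2(3) by blast
  qed
  from *[of N s xs ys] init obtain t s' xs' ys' where
    "exec (WhilePos a c) (s, xs, ys) t (s', xs', ys')"
    "t \<le> N * (5 * width L + cost L c) + 5 * width L" "I N s' xs' ys'" by auto
  moreover have "N * (5 * width L + cost L c) \<le> Suc L * (5 * width L + cost L c)"
    using N by (rule mult_le_mono1)
  ultimately show ?thesis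
    using final unfolding wp_def cost.simps by (meson add_le_mono1 order_trans)
qed

text \<open>Straight-line code and branches are evaluated symbolically, while a loop remains a
  \<open>wp\<close> goal, to be settled by an invariant.\<close>

primrec vc :: "nat \<Rightarrow> com \<Rightarrow> ((nat \<Rightarrow> int) \<Rightarrow> int list \<Rightarrow> int list \<Rightarrow> bool) \<Rightarrow>
    (nat \<Rightarrow> int) \<Rightarrow> int list \<Rightarrow> int list \<Rightarrow> bool" where
  "vc L Skip Q = Q"
| "vc L (Const a z) Q = (\<lambda>s xs ys. a \<le> 99 \<and> small L z \<and> Q (s(a := z)) xs ys)"
| "vc L (Add a b c) Q = (\<lambda>s xs ys. a \<le> 99 \<and> b \<le> 99 \<and> c \<le> 99 \<and>
     small L (s b) \<and> small L (s c) \<and> Q (s(a := s b + s c)) xs ys)"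
| "vc L (Sub a b c) Q = (\<lambda>s xs ys. a \<le> 99 \<and> b \<le> 99 \<and> c \<le> 99 \<and>
     small L (s b) \<and> small L (s c) \<and> Q (s(a := s b - s c)) xs ys)"
| "vc L (Mul a b c) Q = (\<lambda>s xs ys. a \<le> 99 \<and> b \<le> 99 \<and> c \<le> 99 \<and>
     small L (s b) \<and> small L (s c) \<and> Q (s(a := s b * s c)) xs ys)"
| "vc L (Load a b) Q = (\<lambda>s xs ys. a \<le> 99 \<and> b \<le> 99 \<and>
     small L (s b) \<and> small L (s (nat (s b))) \<and> Q (s(a := s (nat (s b)))) xs ys)"
| "vc L (Store a b) Q = (\<lambda>s xs ys. a \<le> 99 \<and> b \<le> 99 \<and>
     small L (s a) \<and> small L (s b) \<and> Q (s(nat (s a) := s b)) xs ys)"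
| "vc L (Read a) Q = (\<lambda>s xs ys. a \<le> 99 \<and> xs \<noteq> [] \<and> small L (hd xs) \<and>
     Q (s(a := hd xs)) (tl xs) ys)"
| "vc L (Print a) Q = (\<lambda>s xs ys. a \<le> 99 \<and> small L (s a) \<and> Q s xs (ys @ [s a]))"
| "vc L (Seq c1 c2) Q = vc L c1 (vc L c2 Q)"
| "vc L (IfPos a c1 c2) Q = (\<lambda>s xs ys. a \<le> 99 \<and> small L (s a) \<and>
     (s a > 0 \<longrightarrow> vc L c1 Q s xs ys) \<and> (\<not> s a > 0 \<longrightarrow> vc L c2 Q s xs ys))"
| "vc L (WhilePos a c) Q = (\<lambda>s xs ys. wp L (WhilePos a c) s xs ys Q)"

text \<open>
  Only fully applied instances are rewritten, so that the state is evaluated before it is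
  substituted; otherwise the terms grow exponentially.
\<close>

lemma vc_simps:
  "vc L Skip Q s xs ys \<longleftrightarrow> Q s xs ys"
  "vc L (Const a z) Q s xs ys \<longleftrightarrow> a \<le> 99 \<and> small L z \<and> Q (s(a := z)) xs ys"
  "vc L (Add a b c) Q s xs ys \<longleftrightarrow> a \<le> 99 \<and> b \<le> 99 \<and> c \<le> 99 \<and>
     small L (s b) \<and> small L (s c) \<and> Q (s(a := s b + s c)) xs ys"
  "vc L (Sub a b c) Q s xs ys \<longleftrightarrow> a \<le> 99 \<and> b \<le> 99 \<and> c \<le> 99 \<and>
     small L (s b) \<and> small L (s c) \<and> Q (s(a := s b - s c)) xs ys"
  "vc L (Mul a b c) Q s xs ys \<longleftrightarrow> a \<le> 99 \<and> b \<le> 99 \<and> c \<le> 99 \<and>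
     small L (s b) \<and> small L (s c) \<and> Q (s(a := s b * s c)) xs ys"
  "vc L (Load a b) Q s xs ys \<longleftrightarrow> a \<le> 99 \<and> b \<le> 99 \<and>
     small L (s b) \<and> small L (s (nat (s b))) \<and> Q (s(a := s (nat (s b)))) xs ys"
  "vc L (Store a b) Q s xs ys \<longleftrightarrow> a \<le> 99 \<and> b \<le> 99 \<and>
     small L (s a) \<and> small L (s b) \<and> Q (s(nat (s a) := s b)) xs ys"
  "vc L (Read a) Q s xs ys \<longleftrightarrow> a \<le> 99 \<and> xs \<noteq> [] \<and> small L (hd xs) \<and>
     Q (s(a := hd xs)) (tl xs) ys"
  "vc L (Print a) Q s xs ys \<longleftrightarrow> a \<le> 99 \<and> small L (s a) \<and> Q s xs (ys @ [s a])"
  "vc L (Seq c1 c2) Q s xs ys \<longleftrightarrow> vc L c1 (vc L c2 Q) s xs ys"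
  "vc L (IfPos a c1 c2) Q s xs ys \<longleftrightarrow> a \<le> 99 \<and> small L (s a) \<and>
     (s a > 0 \<longrightarrow> vc L c1 Q s xs ys) \<and> (\<not> s a > 0 \<longrightarrow> vc L c2 Q s xs ys)"
  "vc L (WhilePos a c1) Q s xs ys \<longleftrightarrow> wp L (WhilePos a c1) s xs ys Q"
  by simp_all

lemma vc_wp: "vc L c Q s xs ys \<Longrightarrow> wp L c s xs ys Q"
proof (induction c arbitrary: Q s xs ys)
  case (Seq c1 c2)
  then show ?case by (auto intro!: wp_Seq wp_conseq[OF Seq.IH(1)] Seq.IH(2))
next
  case (IfPos a c1 c2)
  then show ?case by (auto intro!: wp_IfPos)
qed (auto intro: wp_Skip wp_Const wp_Add wp_Sub wp_Mul wp_Load wp_Store wp_Read wp_Print)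

lemma vc_conseq:
  "vc L c Q s xs ys \<Longrightarrow> (\<And>s xs ys. Q s xs ys \<Longrightarrow> Q' s xs ys) \<Longrightarrow> vc L c Q' s xs ys"
proof (induction c arbitrary: Q Q' s xs ys)
  case (Seq c1 c2)
  then show ?case by (metis vc.simps(10))
qed (auto intro: wp_conseq)

declare vc.simps [simp del]

subsection \<open>Prefix sums of fractions\<close>

text \<open>Fractions are added without cancelling, so only products and sums have to be
  computed.\<close>

primrec prefix_den :: "(nat \<Rightarrow> int) \<Rightarrow> nat \<Rightarrow> int" where
  "prefix_den d 0 = 1"
| "prefix_den d (Suc q) = prefix_den d q * d (Suc q)"

primrec prefix_num :: "(nat \<Rightarrow> int) \<Rightarrow> (nat \<Rightarrow> int) \<Rightarrow> nat \<Rightarrow> int" where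
  "prefix_num a d 0 = 0"
| "prefix_num a d (Suc q) = prefix_num a d q * d (Suc q) + a (Suc q) * prefix_den d q"

lemma prefix_den_pos:
  "(\<And>k. 1 \<le> k \<Longrightarrow> k \<le> q \<Longrightarrow> 0 < d k) \<Longrightarrow> 0 < prefix_den d q"
  by (induction q) auto

lemma prefix_fraction:
  assumes "\<And>k. 1 \<le> k \<Longrightarrow> k \<le> q \<Longrightarrow> 0 < d k"
  shows "(\<Sum>k = 1..q. of_int (a k) / of_int (d k)) =
    (of_int (prefix_num a d q) / of_int (prefix_den d q) :: real)"
  using assms
proof (induction q)
  case (Suc q)
  then have "prefix_den d q \<noteq> 0" "d (Suc q) \<noteq> 0"
    using prefix_den_pos[of q d] by fastforce+
  with Suc show ?case by (simp add: field_simps)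
qed simp

text \<open>Even without cancelling, each new fraction adds only its own bit lengths to the
  exponent.\<close>

lemma prefix_bound:
  "\<bar>prefix_num a d q\<bar> \<le> 2 ^ (\<Sum>k = 1..q. bits (a k) + bits (d k)) \<and>
   \<bar>prefix_den d q\<bar> \<le> 2 ^ (\<Sum>k = 1..q. bits (a k) + bits (d k))"
proof (induction q)
  case (Suc q)
  define e where "e = (\<Sum>k = 1..q. bits (a k) + bits (d k))"
  define x y where "x = a (Suc q)" and "y = d (Suc q)"
  have IH: "\<bar>prefix_num a d q\<bar> \<le> 2 ^ e" "\<bar>prefix_den d q\<bar> \<le> 2 ^ e"
    using Suc by (simp_all add: e_def)
  \<comment> \<open>The new fraction multiplies the bound by at most the sum on the left. Both
    powers are at most half of the right-hand side.\<close>
  have pow: "(2::int) ^ (bits x - 1) + 2 ^ (bits y - 1) \<le> 2 ^ (bits x + bits y)"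
  proof -
    have "(2::int) ^ (bits x - 1) \<le> 2 ^ (bits x + bits y - 1)"
      "(2::int) ^ (bits y - 1) \<le> 2 ^ (bits x + bits y - 1)"
      by (intro power_increasing; simp)+
    moreover have "(2::int) ^ (bits x + bits y) = 2 * 2 ^ (bits x + bits y - 1)"
      using bits_pos[of x] by (simp flip: power_Suc)
    ultimately show ?thesis by linarith
  qed
  have x: "\<bar>x\<bar> \<le> 2 ^ (bits x - 1)" and y: "\<bar>y\<bar> \<le> 2 ^ (bits y - 1)"
    using abs_less_bits[of x] abs_less_bits[of y] by simp_all
  have "\<bar>prefix_num a d q * y\<bar> \<le> 2 ^ e * 2 ^ (bits y - 1)"
    "\<bar>x * prefix_den d q\<bar> \<le> 2 ^ (bits x - 1) * 2 ^ e"
    "\<bar>prefix_den d q * y\<bar> \<le> 2 ^ e * 2 ^ (bits y - 1)"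
    unfolding abs_mult using IH x y by (intro mult_mono; simp)+
  moreover have "2 ^ e * (2 ^ (bits x - 1) + 2 ^ (bits y - 1)) \<le> (2 ^ (e + (bits x + bits y)) :: int)"
    unfolding power_add[of 2 e] using pow by (intro mult_left_mono) auto
  moreover have "(0::int) \<le> 2 ^ e * 2 ^ (bits x - 1)" by simp
  ultimately have "\<bar>prefix_num a d q * y + x * prefix_den d q\<bar> \<le> 2 ^ (e + (bits x + bits y))"
    "\<bar>prefix_den d q * y\<bar> \<le> 2 ^ (e + (bits x + bits y))"
    by (simp_all add: algebra_simps)
  then show ?case by (simp add: x_def y_def e_def)
qed simp

subsection \<open>Reading the instance\<close>

abbreviation and_then :: "com \<Rightarrow> com \<Rightarrow> com" (infixr ";;" 60) where
  "c1 ;; c2 \<equiv> Seq c1 c2"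

text \<open>
  Registers: 2 and 3 hold the constants 1 and 0; 4 is \<open>n\<close>, 5 is \<open>m\<close>, 6 is \<open>2m + 1\<close>; 7, 10, 11, 12
  are the rank, agent, cut and block address of the best move so far; 8 is the round, 9 the number
  of items given away, 13 the number of remaining agents with nonnegative total value; 14 and 15 are
  the current agent and its block address; 16 and 17 are the numerator and the denominator of the total
  value, 18 is positive iff that value is nonnegative; 19 and 20 are the current cut and its
  address, 21 and 22 the numerator and the denominator of a prefix; 25, 26, 27 are loop counters,
  29 is the write address.

  The memory from register 40 on consists of one block per agent with the fractions \<open>S\<^sub>j(q)\<close> for
  \<open>q = 0, ..., m\<close>. The denominator of \<open>S\<^sub>j(0)\<close> is set to 0 once agent \<open>j\<close> has received a bundle.
\<close>

definition read_item :: com where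
  "read_item =
     Read 30 ;; Read 31 ;;
     Mul 21 21 31 ;; Mul 24 30 22 ;; Add 21 21 24 ;; Mul 22 22 31 ;;
     Store 29 21 ;; Add 29 29 2 ;; Store 29 22 ;; Add 29 29 2 ;;
     Sub 25 25 2"

text \<open>The block starts with 0/1 for the empty prefix, taken from the constant registers 3 and
  2. Adding register 3 serves as a copy operation.\<close>

definition read_agent :: com where
  "read_agent =
     Store 29 3 ;; Add 29 29 2 ;; Store 29 2 ;; Add 29 29 2 ;;
     Const 21 0 ;; Const 22 1 ;; Add 25 5 3 ;;
     WhilePos 25 read_item ;;
     Sub 26 26 2"

definition read_all :: com where
  "read_all =
     Const 2 1 ;; Const 3 0 ;; Const 29 40 ;; Add 26 4 3 ;;
     WhilePos 26 read_agent"

text \<open>\<open>L\<close> stands for the input size. It bounds the lengths of all stored numbers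
  and, through \<open>2 * n * m \<le> L\<close>, also the loop counts and addresses.\<close>

locale encoded_instance =
  fixes n m L :: nat and num den :: "nat \<Rightarrow> nat \<Rightarrow> int"
  assumes n: "1 \<le> n" and m: "1 \<le> m" and size: "2 * n * m \<le> L"
    and num_bits: "\<And>j k. j \<in> {1..n} \<Longrightarrow> k \<in> {1..m} \<Longrightarrow> bits (num j k) \<le> L"
    and den_bits: "\<And>j k. j \<in> {1..n} \<Longrightarrow> k \<in> {1..m} \<Longrightarrow> bits (den j k) \<le> L"
    and prefix_num_bits:
      "\<And>j q. j \<in> {1..n} \<Longrightarrow> q \<le> m \<Longrightarrow> bits (prefix_num (num j) (den j) q) \<le> L + 2"
    and prefix_den_bits:
      "\<And>j q. j \<in> {1..n} \<Longrightarrow> q \<le> m \<Longrightarrow> bits (prefix_den (den j) q) \<le> L + 2"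
begin

section \<open>Memory layout and invariants of the reading loops\<close>

lemma n_le: "2 * n \<le> L"
  using m size by (metis mult.right_neutral mult_le_mono2 order_trans)

lemma m_le: "2 * m \<le> L"
  using n size by (metis mult.assoc mult.commute mult.right_neutral mult_le_mono2 order_trans)

text \<open>The address of the numerator of S_j(q), with the denominator in the next cell. The first
  40 cells are registers; then each agent has a block of \<open>m + 1\<close> pairs.\<close>

definition slot :: "nat \<Rightarrow> nat \<Rightarrow> nat" where
  "slot j q = 40 + 2 * ((j - 1) * (m + 1) + q)"

text \<open>One slot past the block is included, because the running addresses get there at the end
  of a loop.\<close>

lemma slot_le:
  assumes "j \<le> n" "q \<le> m + 1"
  shows "slot j q \<le> 40 + 2 * L"
proof -
  have "(j - 1) * (m + 1) \<le> (n - 1) * (m + 1)"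
    using assms by (intro mult_le_mono1) auto
  also have "(n - 1) * (m + 1) + (m + 1) = n * (m + 1)"
    using n by (cases n) auto
  finally have "(j - 1) * (m + 1) + q \<le> n * m + n"
    using assms by simp
  then show ?thesis using size n_le by (simp add: slot_def)
qed

lemma slot_Suc: "slot j (Suc q) = slot j q + 2"
  by (simp add: slot_def)

definition stored :: "nat \<Rightarrow> nat \<Rightarrow> (nat \<Rightarrow> int) \<Rightarrow> bool" where
  "stored j q s \<longleftrightarrow> s (slot j q) = prefix_num (num j) (den j) q \<and>
     s (Suc (slot j q)) = prefix_den (den j) q"

definition row :: "nat \<Rightarrow> nat \<Rightarrow> int list" where
  "row j k = concat (map (\<lambda>k. [num j k, den j k]) [k..<Suc m])"

lemma row_step: "k \<le> m \<Longrightarrow> row j k = num j k # den j k # row j (Suc k)"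
  by (simp add: row_def upt_conv_Cons del: upt_Suc)

text \<open>\<open>s0\<close> is the state at the entry to \<open>read_agent\<close>. The frame
  clause protects everything below the block except scratch registers, hence the outer counters and
  the blocks of earlier agents.\<close>

definition item_inv :: "nat \<Rightarrow> (nat \<Rightarrow> int) \<Rightarrow> int list \<Rightarrow> int list \<Rightarrow>
    nat \<Rightarrow> (nat \<Rightarrow> int) \<Rightarrow> int list \<Rightarrow> int list \<Rightarrow> bool" where
  "item_inv j s0 rest out i s xs ys \<longleftrightarrow>
     s 2 = 1 \<and> s 25 = int (m - i) \<and>
     s 21 = prefix_num (num j) (den j) i \<and> s 22 = prefix_den (den j) i \<and>
     s 29 = int (slot j (Suc i)) \<and> (\<forall>q\<le>i. stored j q s) \<and>
     (\<forall>r<slot j 0. r \<notin> {21, 22, 24, 25, 29, 30, 31} \<longrightarrow> s r = s0 r) \<and>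
     xs = row j (Suc i) @ rest \<and> ys = out"

lemma small_mult: "bits x + bits y \<le> 6 * L + 90 \<Longrightarrow> small L (x * y)"
  using bits_mult[of x y] by (simp add: small_def width_def)

lemma small_add: "bits x \<le> 6 * L + 90 \<Longrightarrow> bits y \<le> 6 * L + 90 \<Longrightarrow> small L (x + y)"
  using bits_add[of x y] by (simp add: small_def width_def)

lemma small_bits: "bits x \<le> 2 * L + 90 \<Longrightarrow> small L x"
  by (simp add: small_def width_def)

lemma nat_int_Suc: "nat (int k + 1) = Suc k"
  by simp

lemma slot_neq: "r < 40 \<Longrightarrow> slot j q \<noteq> r" "r < 40 \<Longrightarrow> Suc (slot j q) \<noteq> r"
  "r < 40 \<Longrightarrow> r \<noteq> slot j q" "r < 40 \<Longrightarrow> r \<noteq> Suc (slot j q)"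
  by (auto simp: slot_def)

lemma slot_inj: "slot j q = slot j q' \<longleftrightarrow> q = q'" "slot j q \<noteq> Suc (slot j q')"
   "Suc (slot j q') \<noteq> slot j q"
  unfolding slot_def by presburger+

lemma slot_not_less: "\<not> slot j q < slot j 0" "\<not> Suc (slot j q) < slot j 0"
  by (simp_all add: slot_def)

lemma slot_ge: "r < 40 \<Longrightarrow> r < slot j q"
  by (simp add: slot_def)

lemma slot_next: "1 \<le> j \<Longrightarrow> slot (Suc j) 0 = slot j (Suc m)"
  by (cases j) (simp_all add: slot_def)

text \<open>Keeps finished blocks intact while later ones are written.\<close>

lemma slot_less:
  assumes "1 \<le> j'" "j' < j" "q \<le> m"
  shows "Suc (slot j' q) < slot j q'"
proof -
  have "j' * (m + 1) \<le> (j - 1) * (m + 1)"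
    using assms by (intro mult_le_mono1) auto
  moreover have "j' * (m + 1) = (j' - 1) * (m + 1) + (m + 1)"
    using assms by (cases j') simp_all
  ultimately show ?thesis using assms by (simp add: slot_def)
qed

lemma wp_read_item:
  assumes j: "j \<in> {1..n}" and inv: "item_inv j s0 rest out i s xs ys" and i: "i < m"
  shows "wp L read_item s xs ys (item_inv j s0 rest out (Suc i))"
proof -
  let ?A = "prefix_num (num j) (den j) i" and ?B = "prefix_den (den j) i"
  let ?u = "num j (Suc i)" and ?v = "den j (Suc i)"
  have xs: "xs = ?u # ?v # row j (Suc (Suc i)) @ rest"
    using inv i by (simp add: item_inv_def row_step)
  have bits: "bits ?A \<le> L + 2" "bits ?B \<le> L + 2" "bits ?u \<le> L" "bits ?v \<le> L"
    using prefix_num_bits[of j i] prefix_den_bits[of j i] num_bits[of j "Suc i"]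
      den_bits[of j "Suc i"] j i by auto
  have regs: "s 2 = 1" "s 25 = int (m - i)" "s 21 = ?A" "s 22 = ?B" "s 29 = int (slot j (Suc i))"
    "ys = out" and st: "\<forall>q\<le>i. stored j q s"
    and frame: "\<forall>r<slot j 0. r \<notin> {21, 22, 24, 25, 29, 30, 31} \<longrightarrow> s r = s0 r"
    using inv by (simp_all add: item_inv_def)
  have "small L ?A" "small L ?B" "small L ?u" "small L ?v"
    using bits by (auto intro!: small_bits)
  moreover have "small L (?A * ?v)" "small L (?u * ?B)" "small L (?B * ?v)"
    using bits by (auto intro!: small_mult)
  moreover have "small L 1" by (auto intro!: small_le)
  moreover note sm = calculation
  have sm2: "small L (?A * ?v + ?u * ?B)"
    using bits bits_mult[of ?A ?v] bits_mult[of ?u ?B] by (intro small_add) auto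
  have "small L (int (slot j (Suc i)))" "small L (int (slot j (Suc i)) + 1)" 
    "small L (int (m - i))"
    using slot_le[of j "Suc i"] j i m_le by (auto intro!: small_le)
  note sm = this sm sm2
  show ?thesis
    apply (rule vc_wp)
    apply (simp add: vc_simps read_item_def xs regs sm slot_neq slot_inj nat_int_Suc)
    using st frame i
    by (simp add: item_inv_def stored_def slot_neq slot_inj slot_Suc[of j "Suc i"] slot_not_less regs le_Suc_eq)
qed

definition agent_inv :: "nat \<Rightarrow> (nat \<Rightarrow> int) \<Rightarrow> int list \<Rightarrow> int list \<Rightarrow> bool" where
  "agent_inv i s xs ys \<longleftrightarrow>
     s 2 = 1 \<and> s 3 = 0 \<and> s 4 = int n \<and> s 5 = int m \<and> s 26 = int (n - i) \<and>
     s 29 = int (slot (Suc i) 0) \<and> (\<forall>j\<in>{1..i}. \<forall>q\<le>m. stored j q s) \<and>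
     xs = concat (map (\<lambda>j. row j 1) [Suc i..<Suc n]) \<and> ys = []"

lemma small_1: "small L 1" "small L 0" "small L 40"
  by (auto intro!: small_le)

lemma small_nat: "k \<le> 6 * L + 90 \<Longrightarrow> small L (int k)"
  by (auto intro!: small_le)

lemma wp_read_agent:
  assumes inv: "agent_inv i s xs ys" and i: "i < n"
  shows "wp L read_agent s xs ys (agent_inv (Suc i))"
proof -
  define j where "j = Suc i"
  define rest where "rest = concat (map (\<lambda>j. row j 1) [Suc j..<Suc n])"
  have j: "j \<in> {1..n}" using i by (simp add: j_def)
  have regs: "s 2 = 1" "s 3 = 0" "s 4 = int n" "s 5 = int m" "s 26 = int (n - i)"
    "s 29 = int (slot j 0)" "ys = []" and st: "\<forall>j\<in>{1..i}. \<forall>q\<le>m. stored j q s"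
    using inv by (simp_all add: agent_inv_def j_def)
  have xs: "xs = row j (Suc 0) @ rest"
    using inv i by (simp add: agent_inv_def rest_def j_def upt_conv_Cons del: upt_Suc)
  have sl: "slot j 0 \<le> 40 + 2 * L" using slot_le[of j 0] j by simp
  have sm: "small L (int (slot j 0))" "small L (int (slot j 0) + 1)" "small L (int m)"
    "small L (int (n - i))" "small L (int n - int i)"
    using sl m_le n_le i by (auto intro!: small_le)
  \<comment> \<open>The code after the inner loop. The frame clause preserves the older blocks, and
    the write address has arrived at the next block by \<open>slot_next\<close>.\<close>
  have final: "vc L (Sub 26 26 2) (agent_inv (Suc i)) s' xs' ys'"
    if fin: "item_inv j s rest [] m s' xs' ys'" for s' xs' ys'
  proof -
    have frame: "s' r = s r" if "r < slot j 0" "r \<notin> {21, 22, 24, 25, 29, 30, 31}" for r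
      using fin that unfolding item_inv_def by blast
    have old: "stored k q s'" if "k \<in> {1..i}" "q \<le> m" for k q
    proof -
      have "Suc (slot k q) < slot j 0" using slot_less[of k j q 0] that by (simp add: j_def)
      moreover have "40 \<le> slot k q" by (simp add: slot_def)
      ultimately show ?thesis using st that frame[of "slot k q"] frame[of "Suc (slot k q)"]
        by (simp add: stored_def)
    qed
    have new: "stored j q s'" if "q \<le> m" for q
      using fin that by (simp add: item_inv_def)
    have regs': "s' 2 = 1" "s' 3 = 0" "s' 4 = int n" "s' 5 = int m" "s' 26 = int (n - i)"
      using regs by (simp_all add: frame slot_ge)
    have fin': "s' 29 = int (slot j (Suc m))" "xs' = rest" "ys' = []"
      using fin by (simp_all add: item_inv_def row_def)
    have "stored k q s'" if "k \<in> {1..Suc i}" "q \<le> m" for k q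
      using old[of k q] new[of q] that by (cases "k = j") (auto simp: j_def)
    then show ?thesis
      using i j by (simp add: vc_simps agent_inv_def regs' fin' sm small_1 stored_def slot_neq
          slot_next rest_def) (simp add: j_def slot_next)
  qed
  show ?thesis
    unfolding read_agent_def
    apply (rule vc_wp)
    apply (simp add: vc_simps regs sm small_1 slot_neq slot_inj nat_int_Suc)
    apply (rule wp_WhilePos[where I = "item_inv j s rest []" and N = m])
    subgoal
      using st by (simp add: item_inv_def stored_def slot_neq slot_inj slot_not_less slot_Suc regs xs)
    subgoal using m_le by simp
    subgoal by simp
    subgoal by (simp add: item_inv_def)
    subgoal using wp_read_item[OF j] by blast
    subgoal using final by (simp add: fun_upd_def)
    done
qed

lemma vc_read_all:
  assumes "s 4 = int n" "s 5 = int m" "xs = concat (map (\<lambda>j. row j 1) [1..<Suc n])" "ys = []"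
  shows "vc L read_all (agent_inv n) s xs ys"
  unfolding read_all_def
  using small_nat[of n] n_le
  apply (simp add: vc_simps assms small_1 del: upt_Suc)
  apply (rule wp_WhilePos[where I = agent_inv and N = n])
  subgoal by (simp add: agent_inv_def assms slot_def del: upt_Suc)
  subgoal using n_le by simp
  subgoal by simp
  subgoal by (simp add: agent_inv_def)
  subgoal by (rule wp_read_agent)
  subgoal by simp
  done

end

subsection \<open>Computing the allocation\<close>

text \<open>Register 23 receives n S_j(q) - r S_j(m) cleared of denominators, plus 1 because
  \<open>IfPos\<close> tests strict positivity. Register 24 receives the rank, and the move is
  recorded only if this is strictly below register 7.\<close>

definition test_move :: com where
  "test_move =
     Load 21 20 ;; Add 20 20 2 ;; Load 22 20 ;; Add 20 20 2 ;;
     Mul 23 4 21 ;; Mul 23 23 17 ;; Mul 24 8 16 ;; Mul 24 24 22 ;; Sub 23 23 24 ;; Add 23 23 2 ;;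
     IfPos 23
       (IfPos 18 (Add 24 19 3) (Sub 24 6 19) ;;
        Sub 23 7 24 ;;
        IfPos 23 (Add 7 24 3 ;; Add 10 14 3 ;; Add 11 19 3 ;; Add 12 15 3) Skip)
       Skip ;;
     Add 19 19 2 ;; Sub 25 25 2"

text \<open>The total is the last fraction of the block, at offset \<open>2 * m\<close>. Its
  denominator is positive, so the numerator decides the sign. The loop runs over the
  \<open>m + 1\<close> cuts from 0 to \<open>m\<close>.\<close>

definition scan_agent :: com where
  "scan_agent =
     Add 20 15 5 ;; Add 20 20 5 ;; Load 16 20 ;; Add 20 20 2 ;; Load 17 20 ;;
     Add 18 16 2 ;; IfPos 18 (Add 13 13 2) Skip ;;
     Const 19 0 ;; Add 20 15 3 ;; Add 25 5 2 ;;
     WhilePos 25 test_move"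

text \<open>The cell loaded is the denominator of S_j(0), which is 1 for an unserved agent and 0 for
  a served one. The block length is \<open>2 * m + 2\<close>.\<close>

definition consider_agent :: com where
  "consider_agent =
     Add 14 14 2 ;; Add 20 15 2 ;; Load 28 20 ;;
     IfPos 28 scan_agent Skip ;;
     Add 15 15 5 ;; Add 15 15 5 ;; Add 15 15 2 ;; Add 15 15 2 ;; Sub 26 26 2"

definition print_winner :: com where
  "print_winner = Print 10 ;; Add 9 9 2 ;; Sub 25 25 2"

text \<open>The store marks the winner as served. Resetting a negative difference to 0 reproduces
  truncated subtraction.\<close>

definition hand_out :: com where
  "hand_out =
     Add 20 12 2 ;; Store 20 3 ;;
     Sub 25 11 9 ;; IfPos 25 Skip (Const 25 0) ;;
     WhilePos 25 print_winner"

text \<open>Register 7 starts at \<open>2 * m + 2\<close>, above every rank. The square of register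
  13 minus 1 is positive unless exactly one agent with nonnegative total remains, and only then is
  the cut moved to \<open>m\<close>.\<close>

definition play_round :: com where
  "play_round =
     Sub 27 27 2 ;; Add 8 8 2 ;; Add 7 5 5 ;; Add 7 7 2 ;; Add 7 7 2 ;;
     Const 13 0 ;; Const 14 0 ;; Const 15 40 ;; Add 26 4 3 ;;
     WhilePos 26 consider_agent ;;
     Sub 23 13 2 ;; Mul 23 23 23 ;; IfPos 23 Skip (Add 11 5 3) ;;
     hand_out"

text \<open>Without items the number of agents may be exponential in the input size.\<close>

definition program :: com where
  "program =
     Read 4 ;; Read 5 ;;
     IfPos 5
       (read_all ;; Add 6 5 5 ;; Add 6 6 2 ;; Const 8 0 ;; Const 9 0 ;; Add 27 4 3 ;;
        WhilePos 27 play_round)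
       Skip"

section \<open>Integer tests and the search for the best move\<close>

lemma fraction_le_iff:
  fixes a b c d r k :: real
  assumes "0 < b" "0 < d"
  shows "r * a / b \<le> k * c / d \<longleftrightarrow> r * a * d \<le> k * c * b"
  using assms by (simp add: pos_divide_le_eq pos_le_divide_eq mult.commute mult.left_commute)

locale encoded_utilities = encoded_instance +
  fixes u :: "nat \<Rightarrow> nat set \<Rightarrow> real"
  assumes additive: "additive_utilities n m u"
    and den_pos: "\<And>j k. j \<in> {1..n} \<Longrightarrow> k \<in> {1..m} \<Longrightarrow> 0 < den j k"
    and item_value: "\<And>j k. j \<in> {1..n} \<Longrightarrow> k \<in> {1..m} \<Longrightarrow>
      u j {k} = real_of_int (num j k) / real_of_int (den j k)"
begin

abbreviation pn :: "nat \<Rightarrow> nat \<Rightarrow> int" where "pn j q \<equiv> prefix_num (num j) (den j) q"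
abbreviation pd :: "nat \<Rightarrow> nat \<Rightarrow> int" where "pd j q \<equiv> prefix_den (den j) q"

lemma pd_pos: "j \<in> {1..n} \<Longrightarrow> q \<le> m \<Longrightarrow> 0 < pd j q"
  by (rule prefix_den_pos) (simp add: den_pos)

lemma prefix_value:
  assumes "j \<in> {1..n}" "q \<le> m"
  shows "u j {1..q} = real_of_int (pn j q) / real_of_int (pd j q)"
proof -
  have "{1..q} \<subseteq> {1..m}" using assms(2) by simp
  then have "u j {1..q} = (\<Sum>k = 1..q. u j {k})"
    using additive assms(1) unfolding additive_utilities_def by blast
  also have "\<dots> = (\<Sum>k = 1..q. real_of_int (num j k) / real_of_int (den j k))"
    using assms by (intro sum.cong) (auto simp: item_value)
  also have "\<dots> = real_of_int (pn j q) / real_of_int (pd j q)"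
    using assms by (intro prefix_fraction) (simp add: den_pos)
  finally show ?thesis .
qed

lemma nonneg_iff: "j \<in> {1..n} \<Longrightarrow> 0 \<le> u j {1..m} \<longleftrightarrow> 0 \<le> pn j m"
  unfolding prefix_value[OF _ order_refl] using pd_pos[of j m]
  by (auto simp: zero_le_divide_iff)

text \<open>Cross-multiplication with positive denominators; the right-hand side is what
  \<open>test_move\<close> evaluates.\<close>

lemma reaches_iff:
  assumes "j \<in> {1..n}" "q \<le> m"
  shows "reaches n m u r j q \<longleftrightarrow> int r * pn j m * pd j q \<le> int n * pn j q * pd j m"
proof -
  have "reaches n m u r j q \<longleftrightarrow>
      of_int (int r * pn j m * pd j q) \<le> (of_int (int n * pn j q * pd j m) :: real)"
    unfolding reaches_def prefix_value[OF assms] prefix_value[OF assms(1) order_refl]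
    using pd_pos[of j m] pd_pos[of j q] assms by (simp add: fraction_le_iff)
  also have "\<dots> \<longleftrightarrow> int r * pn j m * pd j q \<le> int n * pn j q * pd j m"
    by (simp only: of_int_le_iff)
  finally show ?thesis .
qed

text \<open>\<open>V\<close> is the set of moves examined so far. The value \<open>2 * m + 2\<close>
  for \<open>b\<close> means that none was accepted yet; then the other registers are
  unconstrained.\<close>

definition best_of :: "nat \<Rightarrow> (nat \<times> nat) set \<Rightarrow> int \<Rightarrow> int \<Rightarrow> int \<Rightarrow> int \<Rightarrow> bool" where
  "best_of r V b bj bq bd \<longleftrightarrow>
     0 \<le> b \<and> b \<le> 2 * int m + 2 \<and>
     (\<forall>j q. (j, q) \<in> V \<longrightarrow> reaches n m u r j q \<longrightarrow> b \<le> int (rank m u j q)) \<and>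
     (b < 2 * int m + 2 \<longrightarrow> (\<exists>j q. (j, q) \<in> V \<and> reaches n m u r j q \<and> b = int (rank m u j q) \<and>
        bj = int j \<and> bq = int q \<and> bd = int (slot j 0)))"

definition moves :: "nat set \<Rightarrow> nat \<Rightarrow> nat \<Rightarrow> (nat \<times> nat) set" where
  "moves D j q =
     {(j', q'). j' \<in> {1..n} - D \<and> (j' < j \<and> q' \<le> m \<or> j' = j \<and> q' < q)}"

lemma moves_Suc:
  "j \<in> {1..n} - D \<Longrightarrow> moves D j (Suc q) = insert (j, q) (moves D j q)"
  by (auto simp: moves_def)

lemma moves_next: "moves D (Suc j) 0 = moves D j (Suc m)"
  by (auto simp: moves_def)

lemma moves_taken: "j \<in> D \<Longrightarrow> moves D (Suc j) 0 = moves D j 0"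
  by (auto simp: moves_def less_Suc_eq)

lemma best_of_skip:
  assumes "best_of r V b bj bq bd" "\<not> reaches n m u r j q \<or> b \<le> int (rank m u j q)"
  shows "best_of r (insert (j, q) V) b bj bq bd"
  using assms unfolding best_of_def insert_iff prod.inject by blast

lemma best_of_take:
  assumes "best_of r V b bj bq bd" "reaches n m u r j q" "int (rank m u j q) < b"
  shows "best_of r (insert (j, q) V) (int (rank m u j q)) (int j) (int q) (int (slot j 0))"
proof -
  have b: "b \<le> 2 * int m + 2"
    and V: "\<And>j q. (j, q) \<in> V \<Longrightarrow> reaches n m u r j q \<Longrightarrow> b \<le> int (rank m u j q)"
    using assms(1) unfolding best_of_def by blast+
  have "int (rank m u j q) \<le> int (rank m u j' q')"
    if "(j', q') \<in> insert (j, q) V" "reaches n m u r j' q'" for j' q'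
    using V[of j' q'] that assms(3) by auto
  then show ?thesis
    using assms(2,3) b unfolding best_of_def by auto
qed

lemma rank_le: "rank m u j q \<le> 2 * m + 1" if "q \<le> m"
  using that by (auto simp: rank_def)

text \<open>The denominator of S_j(0) can double as the mark of a served agent because its true
  value is always 1.\<close>

definition stored_except :: "nat set \<Rightarrow> (nat \<Rightarrow> int) \<Rightarrow> bool" where
  "stored_except D s \<longleftrightarrow> (\<forall>j\<in>{1..n}. \<forall>q\<le>m. s (slot j q) = pn j q \<and>
     s (Suc (slot j q)) = (if q = 0 \<and> j \<in> D then 0 else pd j q))"

text \<open>The round \<open>r\<close> and the set \<open>D\<close> are separate arguments, because
  register 8 is increased before the winner of the round is marked.\<close>

definition common :: "nat \<Rightarrow> nat set \<Rightarrow> nat \<Rightarrow> (nat \<Rightarrow> int) \<Rightarrow> bool" where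
  "common r D c s \<longleftrightarrow> s 2 = 1 \<and> s 3 = 0 \<and> s 4 = int n \<and> s 5 = int m \<and> s 6 = 2 * int m + 1 \<and>
     s 8 = int r \<and> s 9 = int c \<and> s 27 = int (n - r) \<and> stored_except D s"

definition nonneg_count :: "nat set \<Rightarrow> nat \<Rightarrow> nat" where
  "nonneg_count D j = card {i \<in> nonneg_agents n m u - D. i \<le> j}"

definition move_inv :: "nat \<Rightarrow> nat set \<Rightarrow> nat \<Rightarrow> int list \<Rightarrow> int list \<Rightarrow> nat \<Rightarrow> nat \<Rightarrow>
    (nat \<Rightarrow> int) \<Rightarrow> int list \<Rightarrow> int list \<Rightarrow> bool" where
  "move_inv r D c xs0 ys0 j q s xs ys \<longleftrightarrow>
     common r D c s \<and> xs = xs0 \<and> ys = ys0 \<and>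
     best_of r (moves D j q) (s 7) (s 10) (s 11) (s 12) \<and>
     s 13 = int (nonneg_count D j) \<and> s 14 = int j \<and> s 15 = int (slot j 0) \<and>
     s 16 = pn j m \<and> s 17 = pd j m \<and> s 18 = pn j m + 1 \<and>
     s 19 = int q \<and> s 20 = int (slot j q) \<and> s 25 = int (Suc m - q) \<and>
     s 26 = int (n - (j - 1))"

lemma stored_except_upd:
  "r < 40 \<Longrightarrow> stored_except D (s(r := v)) \<longleftrightarrow> stored_except D s"
  by (simp add: stored_except_def slot_neq)

lemma common_upd:
  "a < 40 \<Longrightarrow> a \<notin> {2, 3, 4, 5, 6, 8, 9, 27} \<Longrightarrow> common r D c (s(a := v)) \<longleftrightarrow> common r D c s"
  by (auto simp: common_def stored_except_upd)

lemma small_big: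
  assumes "bits x \<le> 5 * L + 90"
  shows "small L x" "small L (x + 1)"
  using assms bits_add[of x 1] small_add[of x 1] bits_le_abs[of 1 1]
  by (auto simp: small_def width_def)

lemma wp_test_move:
  assumes inv: "move_inv r D c xs0 ys0 j q s xs ys" and q: "q < Suc m"
    and j: "j \<in> {1..n} - D" and r: "r \<le> n"
  shows "wp L test_move s xs ys (move_inv r D c xs0 ys0 j (Suc q))"
proof -
  have jn: "j \<in> {1..n}" and qm: "q \<le> m" using j q by auto
  have com: "common r D c s" and "best_of r (moves D j q) (s 7) (s 10) (s 11) (s 12)"
    and regs: "xs = xs0" "ys = ys0" "s 13 = int (nonneg_count D j)" "s 14 = int j"
    "s 15 = int (slot j 0)" "s 16 = pn j m" "s 17 = pd j m" "s 18 = pn j m + 1"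
    "s 19 = int q" "s 20 = int (slot j q)" "s 25 = int (Suc m - q)" "s 26 = int (n - (j - 1))"
    using inv by (simp_all add: move_inv_def)
  have best: "best_of r (moves D j q) (s 7) (s 10) (s 11) (s 12)" by fact
  \<comment> \<open>As \<open>j\<close> is unserved, its mark is still the true denominator, which
    matters for \<open>q = 0\<close>.\<close>
  have cregs: "s 2 = 1" "s 3 = 0" "s 4 = int n" "s 5 = int m" "s 6 = 2 * int m + 1" "s 8 = int r"
    and mem: "s (slot j q) = pn j q" "s (Suc (slot j q)) = pd j q"
    using com j qm by (auto simp: common_def stored_except_def)
  let ?l = "int n * pn j q * pd j m - int r * pn j m * pd j q"
  have bits: "bits (pn j q) \<le> L + 2" "bits (pn j m) \<le> L + 2"
    "bits (pd j q) \<le> L + 2" "bits (pd j m) \<le> L + 2" "bits (int n) \<le> L + 1" "bits (int r) \<le> L + 1"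
    using prefix_num_bits[of j] prefix_den_bits[of j] jn qm n_le r
    by (auto intro!: bits_le_abs[of _ L, simplified])
  \<comment> \<open>Lengths of factors add up in a product: the triple products stay within
    \<open>3 * L + 5\<close> bits, and the difference adds one more.\<close>
  have b1: "bits (int n * pn j q) \<le> 2 * L + 3" "bits (int r * pn j m) \<le> 2 * L + 3"
    using bits bits_mult[of "int n" "pn j q"] bits_mult[of "int r" "pn j m"] by linarith+
  have b2: "bits (int n * pn j q * pd j m) \<le> 3 * L + 5" "bits (int r * pn j m * pd j q) \<le> 3 * L + 5"
    using bits b1 bits_mult[of "int n * pn j q" "pd j m"] bits_mult[of "int r * pn j m" "pd j q"]
    by linarith+
  have b3: "bits ?l \<le> 3 * L + 6"
    using b2 bits_diff[of "int n * pn j q * pd j m" "int r * pn j m * pd j q"] by linarith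
  have s7: "0 \<le> s 7" "s 7 \<le> 2 * int m + 2" using best by (simp_all add: best_of_def)
  have sl: "slot j q \<le> 40 + 2 * L" "slot j 0 \<le> 40 + 2 * L"
    using slot_le[of j q] slot_le[of j 0] jn qm by auto
  have sm: "small L (pn j q)" "small L (pd j q)" "small L (pn j m)" "small L (pd j m)"
    using bits by (auto intro!: small_bits)
  have smb: "small L (int n * pn j q)" "small L (int r * pn j m)"
    "small L (int n * pn j q * pd j m)" "small L (int r * pn j m * pd j q)" "small L ?l"
    using b1 b2 b3 by (auto intro: small_big(1))
  have smp: "small L (?l + 1)" "small L (pn j m + 1)"
    using b3 bits by (auto intro: small_big(2))
  have sm2: "small L (int n)" "small L (int m)" "small L (int r)" "small L (int j)" "small L (int q)"
    "small L (int (Suc m - q))" "small L (1 + int m - int q)" "small L (2 * int m + 1)" "small L (s 7)"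
    "small L (int (slot j q))" "small L (int (slot j q) + 1)" "small L (int (slot j 0))"
    "small L (2 * int m + 1 - int q)" "small L (s 7 - int q)" "small L (s 7 - (2 * int m + 1 - int q))"
    using n_le m_le r jn qm sl s7 by (auto intro!: small_le)
  have rk: "0 \<le> pn j m \<Longrightarrow> int (rank m u j q) = int q"
    "\<not> 0 \<le> pn j m \<Longrightarrow> int (rank m u j q) = 2 * int m + 1 - int q"
    using nonneg_iff[OF jn] qm by (auto simp: rank_def)
  note step = moves_Suc[OF j, of q] and re = reaches_iff[OF jn qm, of r]
  let ?reach = "int r * pn j m * pd j q \<le> int n * pn j q * pd j m"
  have skip: "best_of r (moves D j (Suc q)) (s 7) (s 10) (s 11) (s 12)"
    if "\<not> ?reach \<or> s 7 \<le> int (rank m u j q)"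
    unfolding step using that best re by (intro best_of_skip) auto
  have take: "best_of r (moves D j (Suc q)) (int (rank m u j q)) (int j) (int q) (int (slot j 0))"
    if "?reach" "int (rank m u j q) < s 7"
    unfolding step using that best re by (intro best_of_take) auto
  \<comment> \<open>Both outcomes restated with the rank expressions of the two program
    branches.\<close>
  have skips: "\<not> ?reach \<Longrightarrow> best_of r (moves D j (Suc q)) (s 7) (s 10) (s 11) (s 12)"
    "0 \<le> pn j m \<Longrightarrow> \<not> int q < s 7 \<Longrightarrow>
       best_of r (moves D j (Suc q)) (s 7) (s 10) (s 11) (s 12)"
    "\<not> 0 \<le> pn j m \<Longrightarrow> \<not> 2 * int m + 1 - int q < s 7 \<Longrightarrow>
       best_of r (moves D j (Suc q)) (s 7) (s 10) (s 11) (s 12)"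
    using skip rk by auto
  have takes: "?reach \<Longrightarrow> 0 \<le> pn j m \<Longrightarrow> int q < s 7 \<Longrightarrow>
       best_of r (moves D j (Suc q)) (int q) (int j) (int q) (int (slot j 0))"
    "?reach \<Longrightarrow> \<not> 0 \<le> pn j m \<Longrightarrow> 2 * int m + 1 - int q < s 7 \<Longrightarrow>
       best_of r (moves D j (Suc q)) (2 * int m + 1 - int q) (int j) (int q) (int (slot j 0))"
    using take rk by auto
  show ?thesis
    apply (rule vc_wp)
    apply (simp add: test_move_def vc_simps regs cregs mem sm smb smp sm2 small_1 nat_int_Suc slot_neq)
    using q
    apply (simp add: move_inv_def com common_upd regs slot_Suc[of j q] skips takes)
    done
qed

lemma nonneg_count_0: "nonneg_count D 0 = 0"
proof -
  have "{i \<in> nonneg_agents n m u - D. i \<le> 0} = {}"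
    by (auto simp: nonneg_agents_def)
  then show ?thesis by (simp add: nonneg_count_def)
qed

lemma nonneg_count_n: "nonneg_count D n = card (nonneg_agents n m u - D)"
  unfolding nonneg_count_def by (rule arg_cong[where f = card]) (auto simp: nonneg_agents_def)

lemma nonneg_count_step:
  assumes "j \<in> {1..n}"
  shows "nonneg_count D j =
    (if j \<notin> D \<and> 0 \<le> pn j m then Suc (nonneg_count D (j - 1)) else nonneg_count D (j - 1))"
proof -
  define X where "X = (\<lambda>j. {i \<in> nonneg_agents n m u - D. i \<le> j})"
  have fin: "finite (X (j - 1))" by (simp add: X_def nonneg_agents_def)
  have new: "j \<notin> X (j - 1)" using assms by (auto simp: X_def)
  have mem: "j \<in> nonneg_agents n m u \<longleftrightarrow> 0 \<le> pn j m"
    using assms nonneg_iff[OF assms] by (simp add: nonneg_agents_def)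
  have "i \<le> j \<longleftrightarrow> i = j \<or> i \<le> j - 1" for i using assms by auto
  then have "X j = (if j \<notin> D \<and> 0 \<le> pn j m then insert j (X (j - 1)) else X (j - 1))"
    using mem unfolding X_def by auto
  moreover have "nonneg_count D k = card (X k)" for k
    by (simp add: nonneg_count_def X_def)
  ultimately show ?thesis using fin new by simp
qed

lemma nonneg_count_le: "nonneg_count D j \<le> n"
proof -
  have "card {i \<in> nonneg_agents n m u - D. i \<le> j} \<le> card {1..n}"
    by (rule card_mono) (auto simp: nonneg_agents_def)
  then show ?thesis by (simp add: nonneg_count_def)
qed

text \<open>The postcondition is arbitrary because the scan lies inside a branch of
  \<open>consider_agent\<close>; the code after that branch becomes its continuation.\<close>

lemma vc_scan_agent:
  assumes com: "common r D c s" and j: "j \<in> {1..n} - D" and r: "r \<le> n"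
    and best: "best_of r (moves D j 0) (s 7) (s 10) (s 11) (s 12)"
    and regs: "s 13 = int (nonneg_count D (j - 1))" "s 14 = int j" "s 15 = int (slot j 0)"
      "s 26 = int (n - (j - 1))"
    and Q: "\<And>s'. move_inv r D c xs ys j (Suc m) s' xs ys \<Longrightarrow> Q s' xs ys"
  shows "vc L scan_agent Q s xs ys"
proof -
  have jn: "j \<in> {1..n}" "j \<notin> D" using j by auto
  have cregs: "s 2 = 1" "s 3 = 0" "s 4 = int n" "s 5 = int m" "s 6 = 2 * int m + 1" "s 8 = int r"
    and mem: "s (slot j m) = pn j m" "s (Suc (slot j m)) = pd j m"
    using com jn m by (auto simp: common_def stored_except_def)
  have addr: "int (slot j 0) + int m + int m = int (slot j m)"
    by (simp add: slot_def)
  have bits: "bits (pn j m) \<le> L + 2" "bits (pd j m) \<le> L + 2"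
    using prefix_num_bits[of j m] prefix_den_bits[of j m] jn by auto
  have sm: "small L (pn j m)" "small L (pd j m)" "small L (pn j m + 1)"
    using bits by (auto intro: small_big)
  have sm2: "small L (int (slot j 0))" "small L (int (slot j 0) + int m)" "small L (int (slot j m))"
    "small L (int (slot j m) + 1)" "small L (int m)" "small L (int (nonneg_count D (j - 1)))"
    "small L (int (nonneg_count D (j - Suc 0)))"
    using slot_le[of j m] slot_le[of j 0] jn m_le n_le nonneg_count_le[of D "j - 1"]
    by (auto intro!: small_le)
  have loop: "wp L (WhilePos 25 test_move) s' xs ys Q"
    if "move_inv r D c xs ys j 0 s' xs ys" for s'
  proof (rule wp_WhilePos[where I = "move_inv r D c xs ys j" and N = "Suc m"])
    show "Suc m \<le> Suc L" using m_le by simp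
    show "wp L test_move s xs' ys' (move_inv r D c xs ys j (Suc q))"
      if "move_inv r D c xs ys j q s xs' ys'" "q < Suc m" for q s xs' ys'
      using wp_test_move[OF that j r] .
    show "Q s xs' ys'" if "move_inv r D c xs ys j (Suc m) s xs' ys'" for s xs' ys'
    proof -
      have "xs' = xs" "ys' = ys" using that by (simp_all add: move_inv_def)
      then show ?thesis using Q that by simp
    qed
  qed (use that in \<open>simp_all add: move_inv_def\<close>)
  show ?thesis
    apply (cases "0 \<le> pn j m")
    subgoal
      apply (simp add: scan_agent_def vc_simps regs cregs mem sm sm2 addr small_1 nat_int_Suc slot_neq)
      apply (rule loop)
      using nonneg_count_step[OF jn(1), of D] jn best
      apply (simp add: move_inv_def com common_upd regs)
      done
    subgoal
      apply (simp add: scan_agent_def vc_simps regs cregs mem sm sm2 addr small_1 nat_int_Suc slot_neq)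
      apply (rule loop)
      using nonneg_count_step[OF jn(1), of D] jn best
      apply (simp add: move_inv_def com common_upd regs)
      done
    done
qed

definition consider_inv :: "nat \<Rightarrow> nat set \<Rightarrow> nat \<Rightarrow> int list \<Rightarrow> int list \<Rightarrow> nat \<Rightarrow>
    (nat \<Rightarrow> int) \<Rightarrow> int list \<Rightarrow> int list \<Rightarrow> bool" where
  "consider_inv r D c xs0 ys0 i s xs ys \<longleftrightarrow>
     common r D c s \<and> xs = xs0 \<and> ys = ys0 \<and>
     best_of r (moves D (Suc i) 0) (s 7) (s 10) (s 11) (s 12) \<and>
     s 13 = int (nonneg_count D i) \<and> s 14 = int i \<and> s 15 = int (slot (Suc i) 0) \<and>
     s 26 = int (n - i)"

lemma wp_consider_agent:
  assumes inv: "consider_inv r D c xs0 ys0 i s xs ys" and i: "i < n" and r: "r \<le> n"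
  shows "wp L consider_agent s xs ys (consider_inv r D c xs0 ys0 (Suc i))"
proof -
  define j where "j = Suc i"
  have j: "j \<in> {1..n}" using i by (simp add: j_def)
  have com: "common r D c s" and best: "best_of r (moves D j 0) (s 7) (s 10) (s 11) (s 12)"
    and regs: "xs = xs0" "ys = ys0" "s 13 = int (nonneg_count D i)" "s 14 = int i"
      "s 15 = int (slot j 0)" "s 26 = int (n - i)"
    using inv by (simp_all add: consider_inv_def j_def)
  have cregs: "s 2 = 1" "s 3 = 0" "s 4 = int n" "s 5 = int m"
    using com by (auto simp: common_def)
  have mem: "s (Suc (slot j 0)) = (if j \<in> D then 0 else 1)"
    using com j by (auto simp: common_def stored_except_def)
  have sl: "slot j 0 + 2 * m + 2 \<le> 40 + 2 * L"
    using slot_le[of j "Suc m"] j by (simp add: slot_def)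
  have addr: "int (slot j 0) + int m + int m + 1 + 1 = int (slot (Suc j) 0)"
    using slot_next[of j] j by (simp add: slot_def)
  have sm: "small L (int i)" "small L (int m)" "small L (int n - int i)" "small L (int (n - i))"
    "small L (int (slot j 0))" "small L (int (slot j 0) + int m)" "small L (int (slot j 0) + 1)"
    "small L (int (slot j 0) + int m + int m)" "small L (int (slot j 0) + int m + int m + 1)"
    "small L (2 * int m + int (slot j 0))" "small L (2 * int m + int (slot j 0) + 1)"
    using sl m_le n_le i by (auto intro!: small_le)
  have addr': "2 + (2 * int m + int (slot j 0)) = int (slot (Suc j) 0)"
    using addr by simp
  have left: "int (n - i) - 1 = int (n - j)" using i by (simp add: j_def)
  \<comment> \<open>The code after the branch, treated once for served and unserved agents.\<close>
  define tail where "tail = (Add 15 15 5 ;; Add 15 15 5 ;; Add 15 15 2 ;; Add 15 15 2 ;; Sub 26 26 2)"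
  have tail: "vc L tail (consider_inv r D c xs0 ys0 j) s' xs0 ys0"
    if "common r D c s'" "best_of r (moves D (Suc j) 0) (s' 7) (s' 10) (s' 11) (s' 12)"
      "s' 13 = int (nonneg_count D j)" "s' 14 = int j" "s' 15 = int (slot j 0)"
      "s' 26 = int (n - i)" for s'
  proof -
    have cr: "s' 2 = 1" "s' 5 = int m" using that(1) by (simp_all add: common_def)
    show ?thesis
      using that(2) unfolding tail_def
      by (simp add: vc_simps that(1,3-) cr sm small_1 addr addr' left consider_inv_def common_upd)
  qed
  have jD: "vc L tail (consider_inv r D c xs0 ys0 j)
      (s(14 := int j, 20 := int (slot j 0) + 1, 28 := 0)) xs0 ys0" if "j \<in> D"
    using that best nonneg_count_step[OF j, of D] moves_taken[OF that]
    by (intro tail) (simp_all add: com common_upd regs j_def)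
  have jnD: "vc L scan_agent (vc L tail (consider_inv r D c xs0 ys0 j))
      (s(14 := int j, 20 := int (slot j 0) + 1, 28 := 1)) xs0 ys0" if "j \<notin> D"
  proof (rule vc_scan_agent)
    fix s' assume "move_inv r D c xs0 ys0 j (Suc m) s' xs0 ys0"
    then show "vc L tail (consider_inv r D c xs0 ys0 j) s' xs0 ys0"
      by (intro tail) (simp_all add: move_inv_def moves_next j_def)
  qed (use that best j r in \<open>simp_all add: com common_upd regs, simp_all add: j_def\<close>)
  have ji: "int i + 1 = int j" by (simp add: j_def)
  show ?thesis
    unfolding consider_agent_def tail_def[symmetric]
    apply (rule vc_wp)
    apply (fold j_def)
    using jD jnD
    apply (cases "j \<in> D")
     apply (simp_all add: vc_simps regs cregs sm small_1 nat_int_Suc slot_neq mem ji)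
    done
qed

section \<open>Marking the winner and printing the bundle\<close>

lemma slot_eq_iff:
  assumes "1 \<le> j" "1 \<le> j'" "q \<le> m" "q' \<le> m"
  shows "slot j q = slot j' q' \<longleftrightarrow> j = j' \<and> q = q'"
    "Suc (slot j q) = Suc (slot j' q') \<longleftrightarrow> j = j' \<and> q = q'"
    "slot j q \<noteq> Suc (slot j' q')"
proof -
  show "slot j q = slot j' q' \<longleftrightarrow> j = j' \<and> q = q'"
    using slot_less[of j j' q q'] slot_less[of j' j q' q] slot_inj(1)[of j q q'] assms
    by (cases j j' rule: linorder_cases) auto
  then show "Suc (slot j q) = Suc (slot j' q') \<longleftrightarrow> j = j' \<and> q = q'" by simp
  show "slot j q \<noteq> Suc (slot j' q')" unfolding slot_def by presburger
qed

lemma common_take: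
  assumes "common r D c s" "j \<in> {1..n}"
  shows "common r (insert j D) c (s(Suc (slot j 0) := 0))"
proof -
  have "stored_except (insert j D) (s(Suc (slot j 0) := 0))"
    unfolding stored_except_def
  proof (intro ballI allI impI)
    fix i q assume "i \<in> {1..n}" "q \<le> m"
    then show "(s(Suc (slot j 0) := 0)) (slot i q) = pn i q \<and>
        (s(Suc (slot j 0) := 0)) (Suc (slot i q)) = (if q = 0 \<and> i \<in> insert j D then 0 else pd i q)"
      using assms slot_eq_iff[of i j q 0] unfolding common_def stored_except_def by simp
  qed
  then show ?thesis using assms(1) by (simp add: common_def slot_neq)
qed

lemma common_print:
  "common r D c s \<Longrightarrow> common r D c' (s(9 := int c'))"
  by (simp add: common_def stored_except_upd)

definition print_inv :: "nat \<Rightarrow> nat set \<Rightarrow> int list \<Rightarrow> nat \<Rightarrow> nat \<Rightarrow> nat \<Rightarrow>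
    (nat \<Rightarrow> int) \<Rightarrow> int list \<Rightarrow> int list \<Rightarrow> bool" where
  "print_inv r D ys0 j N k s xs ys \<longleftrightarrow>
     common r D (length ys0 + k) s \<and> s 10 = int j \<and> s 25 = int (N - k) \<and>
     ys = ys0 @ replicate k (int j)"

lemma wp_print_winner:
  assumes inv: "print_inv r D ys0 j N k s xs ys" and k: "k < N" and N: "length ys0 + N \<le> m"
    and j: "j \<in> {1..n}"
  shows "wp L print_winner s xs ys (print_inv r D ys0 j N (Suc k))"
proof -
  have com: "common r D (length ys0 + k) s" and regs: "s 10 = int j" "s 25 = int (N - k)"
    and ys: "ys = ys0 @ replicate k (int j)"
    using inv by (simp_all add: print_inv_def)
  have cregs: "s 2 = 1" "s 9 = int (length ys0 + k)" using com by (simp_all add: common_def)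
  have sm: "small L (int j)" "small L (int (N - k))" "small L (int (length ys0) + int k)"
    "small L (int (length ys0 + k))"
    using m_le n_le j k N by (auto intro!: small_le)
  have s9: "int (length ys0) + int k + 1 = int (length ys0 + Suc k)"
    "int (length ys0 + k) + 1 = int (length ys0 + Suc k)" by simp_all
  have left: "int (N - k) - 1 = int (N - Suc k)" using k by simp
  have com': "common r D (length ys0 + Suc k) (s(9 := int (length ys0 + Suc k)))"
    using com by (rule common_print)
  show ?thesis
    apply (rule vc_wp)
    using com'
    apply (simp add: print_winner_def vc_simps regs cregs sm small_1 s9 left print_inv_def common_upd
        ys replicate_append_same del: of_nat_add of_nat_Suc)
    done
qed

lemma vc_hand_out:
  assumes com: "common r D (length ys) s" and j: "j \<in> {1..n}" and q: "q \<le> m"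
    and len: "length ys \<le> m"
    and regs: "s 10 = int j" "s 11 = int q" "s 12 = int (slot j 0)"
  shows "vc L hand_out (\<lambda>s' xs' ys'. ys' = ys @ replicate (q - length ys) (int j) \<and>
    common r (insert j D) (length ys') s') s xs ys"
proof -
  let ?N = "q - length ys"
  have cregs: "s 2 = 1" "s 3 = 0" "s 9 = int (length ys)" using com by (simp_all add: common_def)
  have sl: "slot j 0 \<le> 40 + 2 * L" using slot_le[of j 0] j by simp
  have sm: "small L (int (slot j 0))" "small L (int (slot j 0) + 1)" "small L (int q)"
    "small L (int (length ys))" "small L (int q - int (length ys))"
    using sl m_le q len by (auto intro!: small_le)
  have loop: "wp L (WhilePos 25 print_winner) s' xs ys
      (\<lambda>s' xs' ys'. ys' = ys @ replicate ?N (int j) \<and> common r (insert j D) (length ys') s')"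
    if "print_inv r (insert j D) ys j ?N 0 s' xs ys" for s'
  proof (rule wp_WhilePos[where I = "print_inv r (insert j D) ys j ?N" and N = ?N])
    show "?N \<le> Suc L" using m_le q by simp
    show "wp L print_winner s xs' ys' (print_inv r (insert j D) ys j ?N (Suc k))"
      if "print_inv r (insert j D) ys j ?N k s xs' ys'" "k < ?N" for k s xs' ys'
      by (rule wp_print_winner[OF that]) (use j q that in simp_all)
  qed (use that in \<open>simp_all add: print_inv_def\<close>)
  have taken: "common r (insert j D) (length ys) (s(20 := v, Suc (slot j 0) := 0))" for v
    using com by (intro common_take j) (simp add: common_upd)
  show ?thesis
  proof (cases "length ys < q")
    case True
    then show ?thesis
      apply (simp add: hand_out_def vc_simps regs cregs sm small_1 nat_int_Suc slot_neq)
      apply (rule loop)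
      apply (simp add: print_inv_def regs slot_neq common_upd taken of_nat_diff)
      done
  next
    case False
    then have N: "?N = 0" by simp
    show ?thesis
      using False
      apply (simp add: hand_out_def vc_simps regs cregs sm small_1 nat_int_Suc slot_neq)
      apply (rule loop[unfolded N, simplified])
      apply (simp add: print_inv_def regs slot_neq common_upd taken)
      done
  qed
qed

section \<open>A full round and the whole run\<close>

definition round_inv :: "nat \<Rightarrow> (nat \<Rightarrow> int) \<Rightarrow> int list \<Rightarrow> int list \<Rightarrow> bool" where
  "round_inv i s xs ys \<longleftrightarrow> (\<exists>D. progress n m u i D ys \<and> common i D (length ys) s)"

text \<open>After the scan \<open>moves D (Suc n) 0\<close> contains every move of an unserved
  agent. Some acceptable move exists and has rank at most \<open>2 * m + 1\<close>, so the initial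
  value of \<open>b\<close> has been replaced.\<close>

lemma best_of_best_move:
  assumes "progress n m u i D ys" "i < n"
    and "best_of (Suc i) (moves D (Suc n) 0) b bj bq bd"
  shows "\<exists>j q. best_move n m u i D j q \<and> bj = int j \<and> bq = int q \<and> bd = int (slot j 0)"
proof -
  have V: "(j, q) \<in> moves D (Suc n) 0 \<longleftrightarrow> j \<in> {1..n} - D \<and> q \<le> m" for j q
    by (auto simp: moves_def)
  obtain j q where "best_move n m u i D j q"
    using best_move_exists[OF additive assms(1,2)] by blast
  then have "j \<in> {1..n} - D" "q \<le> m" "reaches n m u (Suc i) j q"
    by (simp_all add: best_move_def)
  then have "b \<le> int (rank m u j q)"
    using assms(3) V unfolding best_of_def by blast
  then have "b < 2 * int m + 2" using rank_le[OF \<open>q \<le> m\<close>, of j] by linarith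
  then obtain j q where "(j, q) \<in> moves D (Suc n) 0" "reaches n m u (Suc i) j q"
    "b = int (rank m u j q)" "bj = int j" "bq = int q" "bd = int (slot j 0)"
    using assms(3) unfolding best_of_def by blast
  moreover have "b \<le> int (rank m u j' q')"
    if "j' \<in> {1..n} - D" "q' \<le> m" "reaches n m u (Suc i) j' q'" for j' q'
    using assms(3) V that unfolding best_of_def by blast
  ultimately show ?thesis
    unfolding best_move_def V by (metis of_nat_le_iff)
qed

lemma wp_play_round:
  assumes inv: "round_inv i s xs ys" and i: "i < n"
  shows "wp L play_round s xs ys (round_inv (Suc i))"
proof -
  obtain D where prog: "progress n m u i D ys" and com: "common i D (length ys) s"
    using inv by (auto simp: round_inv_def)
  have len: "length ys \<le> m" using prog unfolding progress_def by blast
  have cregs: "s 2 = 1" "s 3 = 0" "s 4 = int n" "s 5 = int m" "s 6 = 2 * int m + 1"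
    "s 8 = int i" "s 9 = int (length ys)" "s 27 = int (n - i)" "stored_except D s"
    using com by (simp_all add: common_def)
  have sm: "small L (int n)" "small L (int m)" "small L (int i)" "small L (int (n - i))"
    "small L (int m + int m)" "small L (2 * int m)" "small L (2 * int m + 1)" "small L (int m + int m + 1)"
    using m_le n_le i by (auto intro!: small_le)
  have left: "int (n - i) - 1 = int (n - Suc i)" using i by simp
  define tail where "tail = (Sub 23 13 2 ;; Mul 23 23 23 ;; IfPos 23 Skip (Add 11 5 3) ;; hand_out)"
  have tail: "vc L tail (round_inv (Suc i)) s' xs' ys'"
    if fin: "consider_inv (Suc i) D (length ys) xs ys n s' xs' ys'" for s' xs' ys'
  proof -
    have com': "common (Suc i) D (length ys) s'" and eqs: "xs' = xs" "ys' = ys"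
      and cnt: "s' 13 = int (card (nonneg_agents n m u - D))"
      and "best_of (Suc i) (moves D (Suc n) 0) (s' 7) (s' 10) (s' 11) (s' 12)"
      using fin by (simp_all add: consider_inv_def nonneg_count_n)
    then obtain j q where bm: "best_move n m u i D j q"
      and regs: "s' 10 = int j" "s' 11 = int q" "s' 12 = int (slot j 0)"
      using best_of_best_move[OF prog i] by blast
    have j: "j \<in> {1..n}" and q: "q \<le> m" using bm by (auto simp: best_move_def)
    have cr: "s' 2 = 1" "s' 3 = 0" "s' 5 = int m" using com' by (simp_all add: common_def)
    define k where "k = card (nonneg_agents n m u - D)"
    have k: "k \<le> n" using nonneg_count_le[of D n] by (simp add: nonneg_count_n k_def)
    have cnt: "s' 13 = int k" using cnt by (simp add: k_def)
    have smk: "small L (int k)" "small L (int k - 1)" "small L (int m)"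
      using k n_le m_le by (auto intro!: small_le)
    have "bits (int k - 1) \<le> L + 1"
      using k n_le n bits_le_abs[of "int k - 1" L] by simp
    then have smk2: "small L ((int k - 1) * (int k - 1))"
      using bits_mult[of "int k - 1" "int k - 1"] by (simp add: small_def width_def)
    have hand: "vc L hand_out (round_inv (Suc i)) s'' xs ys"
      if "common (Suc i) D (length ys) s''" "s'' 10 = int j" "s'' 12 = int (slot j 0)"
        "s'' 11 = int (if k = 1 then m else q)" for s''
    proof (rule vc_conseq[OF vc_hand_out])
      show "(if k = 1 then m else q) \<le> m" using q by simp
      fix s xs' ys'
      assume post: "ys' = ys @ replicate ((if k = 1 then m else q) - length ys) (int j) \<and>
        common (Suc i) (insert j D) (length ys') s"
      have "progress n m u (Suc i) (insert j D) ys'"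
        using progress_step[OF additive prog i bm refl] post unfolding k_def by metis
      then show "round_inv (Suc i) s xs' ys'" using post by (auto simp: round_inv_def)
    qed (use that j len in auto)
    show ?thesis
    proof (cases "k = 1")
      case True
      then have "s' 13 = 1" using cnt by simp
      then show ?thesis
        unfolding tail_def eqs
        apply (simp add: vc_simps cr smk small_1)
        apply (rule hand)
        apply (simp_all add: com' common_upd regs True)
        done
    next
      case False
      then have "int k - 1 \<noteq> 0" by linarith
      then have "0 < (int k - 1) * (int k - 1)"
        by (metis power2_eq_square zero_less_power2)
      then show ?thesis
        unfolding tail_def eqs using cnt
        apply (simp add: vc_simps cr smk smk2 small_1)
        apply (rule hand)
        using False apply (simp_all add: com' common_upd regs)
        done
    qed
  qed
  show ?thesis
    unfolding play_round_def tail_def[symmetric]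
    apply (rule vc_wp)
    apply (simp add: vc_simps cregs sm small_1 left)
    apply (rule wp_WhilePos[where I = "consider_inv (Suc i) D (length ys) xs ys" and N = n])
    subgoal
      using m_le i
      by (simp add: consider_inv_def common_def cregs stored_except_upd nonneg_count_0 slot_def
          best_of_def moves_def)
    subgoal using n_le by simp
    subgoal by simp
    subgoal by (simp add: consider_inv_def)
    subgoal using i by (intro wp_consider_agent) simp_all
    subgoal by (rule tail)
    done
qed

lemma wp_program:
  "wp L program (\<lambda>_. 0) (int n # int m # concat (map (\<lambda>j. row j 1) [1..<Suc n])) []
     (\<lambda>s xs ys. \<exists>D. progress n m u n D ys)"
proof -
  let ?init = "Add 6 5 5 ;; Add 6 6 2 ;; Const 8 0 ;; Const 9 0 ;; Add 27 4 3 ;;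
    WhilePos 27 play_round"
  have sm: "small L (int n)" "small L (int m)" "small L (2 * int m)" "small L (int m + int m)"
    using m_le n_le by (auto intro!: small_le)
  have rounds: "vc L ?init (\<lambda>s xs ys. \<exists>D. progress n m u n D ys) s xs ys"
    if read: "agent_inv n s xs ys" for s xs ys
  proof -
    have regs: "s 2 = 1" "s 3 = 0" "s 4 = int n" "s 5 = int m" "ys = []"
      and st: "\<forall>j\<in>{1..n}. \<forall>q\<le>m. stored j q s"
      using read by (simp_all add: agent_inv_def)
    have "progress n m u 0 {} []" using progress_init[OF n] .
    moreover have "stored_except {} s"
      using st unfolding stored_except_def stored_def by simp
    ultimately have start: "round_inv 0 (s(6 := 2 * int m + 1, 8 := 0, 9 := 0, 27 := int n)) xs []"
      unfolding round_inv_def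
      by (intro exI[of _ "{}"]) (simp add: common_def regs stored_except_upd)
    show ?thesis
      apply (simp add: vc_simps regs sm small_1)
      apply (rule wp_WhilePos[where I = round_inv and N = n])
      subgoal using start by simp
      subgoal using n_le by simp
      subgoal by simp
      subgoal by (auto simp: round_inv_def common_def)
      subgoal by (rule wp_play_round)
      subgoal by (auto simp: round_inv_def)
      done
  qed
  have "vc L (read_all ;; ?init) (\<lambda>s xs ys. \<exists>D. progress n m u n D ys)
      ((\<lambda>_. 0)(4 := int n, 5 := int m)) (concat (map (\<lambda>j. row j 1) [1..<Suc n])) []"
    unfolding vc_simps(10)[of L read_all]
    by (rule vc_conseq[OF vc_read_all rounds]) simp_all
  then show ?thesis
    using m unfolding program_def
    by (intro vc_wp) (simp add: vc_simps(8,10,11) sm)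
qed

end

section \<open>The input size as a bound on lengths and loops\<close>

lemma input_size_row:
  "input_size (concat (map (\<lambda>j. [a j, d j]) [1..<Suc q])) = (\<Sum>k = 1..q. bits (a k) + bits (d k))"
  by (induction q) (simp_all add: input_size_def)

lemma input_size_rows:
  "input_size (concat (map f [1..<Suc k])) = (\<Sum>i = 1..k. input_size (f i))"
  by (induction k) (simp_all add: input_size_def)

lemma input_size_instance:
  "input_size (instance_code n m num den) = bits (int n) + bits (int m) +
     (\<Sum>i = 1..n. \<Sum>k = 1..m. bits (num i k) + bits (den i k))"
proof -
  have "input_size (instance_code n m num den) = bits (int n) + bits (int m) +
      input_size (concat (map (\<lambda>i. concat (map (\<lambda>j. [num i j, den i j]) [1..<Suc m])) [1..<Suc n]))"
    unfolding instance_code_def by (simp add: input_size_def del: upt_Suc)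
  then show ?thesis
    by (simp only: input_size_row
        input_size_rows[of "\<lambda>i. concat (map (\<lambda>j. [num i j, den i j]) [1..<Suc m])" n])
qed

text \<open>Each of the \<open>2 * n * m\<close> numbers in the table contributes at least one bit.
  The prefix sums of an agent are bounded by the lengths in one row, which sum to at most the input
  size.\<close>

lemma encoded_instance_input_size:
  assumes "1 \<le> n" "1 \<le> m"
  shows "encoded_instance n m (input_size (instance_code n m num den)) num den"
proof
  define L where "L = input_size (instance_code n m num den)"
  let ?b = "\<lambda>i k. bits (num i k) + bits (den i k)"
  have L: "L = bits (int n) + bits (int m) + (\<Sum>i = 1..n. \<Sum>k = 1..m. ?b i k)"
    by (simp add: L_def input_size_instance)
  have row: "(\<Sum>k = 1..q. ?b i k) \<le> L" if "i \<in> {1..n}" "q \<le> m" for i q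
  proof -
    have "(\<Sum>k = 1..q. ?b i k) \<le> (\<Sum>k = 1..m. ?b i k)"
      using that by (intro sum_mono2) auto
    also have "\<dots> \<le> (\<Sum>i = 1..n. \<Sum>k = 1..m. ?b i k)"
      using that(1) by (intro member_le_sum) auto
    finally show ?thesis using L by linarith
  qed
  have item: "?b i k \<le> L" if "i \<in> {1..n}" "k \<in> {1..m}" for i k
  proof -
    have "?b i k \<le> (\<Sum>k = 1..m. ?b i k)"
      using that(2) by (intro member_le_sum) auto
    then show ?thesis using row[OF that(1) order_refl] by linarith
  qed
  have "2 \<le> ?b i k" for i k
    using bits_pos[of "num i k"] bits_pos[of "den i k"] by linarith
  then have "(\<Sum>i = 1..n. \<Sum>k = 1..m. 2) \<le> (\<Sum>i = 1..n. \<Sum>k = 1..m. ?b i k)"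
    by (intro sum_mono)
  then show "2 * n * m \<le> input_size (instance_code n m num den)"
    using L by (simp add: L_def)
  fix i k
  show "bits (num i k) \<le> input_size (instance_code n m num den)"
    "bits (den i k) \<le> input_size (instance_code n m num den)"
    if "i \<in> {1..n}" "k \<in> {1..m}"
    using item[OF that] by (simp_all add: L_def)
  \<comment> \<open>The bound \<open>2 ^ e\<close> is not strict, which costs one bit, and
    \<open>bits\<close> is the binary length plus 1; hence \<open>L + 2\<close>.\<close>
  have bound: "bits x \<le> L + 2" if "\<bar>x\<bar> \<le> 2 ^ e" "e \<le> L" for x e
  proof -
    have "(2::int) ^ e < 2 ^ Suc L" using that(2) by (intro power_strict_increasing) auto
    then have "bits x \<le> Suc (Suc L)" using that(1) unfolding bits_le_iff by linarith
    then show ?thesis by simp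
  qed
  show "bits (prefix_num (num i) (den i) k) \<le> input_size (instance_code n m num den) + 2"
    "bits (prefix_den (den i) k) \<le> input_size (instance_code n m num den) + 2"
    if "i \<in> {1..n}" "k \<le> m"
    using bound[OF _ row[OF that]] prefix_bound[of "num i" "den i" k] by (simp_all add: L_def)
qed (use assms in simp_all)

lemma wp_program_no_items:
  assumes "bits (int n) \<le> L"
  shows "wp L program (\<lambda>_. 0) [int n, 0] [] (\<lambda>s xs ys. ys = [])"
proof -
  have "small L (int n)" "small L 0"
    using assms small_le[of 0 L] by (simp_all add: small_def width_def)
  then show ?thesis
    unfolding program_def by (intro vc_wp) (simp add: vc_simps)
qed

text \<open>All bundles are empty, and every proportional share is the value of the empty set
  divided by \<open>n\<close>, that is 0.\<close>

lemma no_items_allocation: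
  assumes "additive_utilities n 0 u"
  shows "connected_allocation n 0 (decode_allocation [])" "PROP1_outer n 0 u (decode_allocation [])"
proof -
  have dec: "decode_allocation [] = (\<lambda>i. {})" by (auto simp: decode_allocation_def)
  have "connected_items 0 {}" unfolding connected_items_def by (auto intro: exI[of _ 1])
  then show "connected_allocation n 0 (decode_allocation [])"
    unfolding dec connected_allocation_def allocation_def disjoint_family_on_def by simp
  show "PROP1_outer n 0 u (decode_allocation [])"
    using additive_empty[OF assms] unfolding dec PROP1_outer_def by simp
qed

lemma program_correct:
  assumes n: "1 \<le> n" and add: "additive_utilities n m u"
    and vals: "\<forall>i\<in>{1..n}. \<forall>j\<in>{1..m}.
      den i j > 0 \<and> u i {j} = real_of_int (num i j) / real_of_int (den i j)"
  shows "wp (input_size (instance_code n m num den)) program (\<lambda>_. 0) (instance_code n m num den) []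
    (\<lambda>s xs ys. length ys = m \<and> connected_allocation n m (decode_allocation ys) \<and>
       PROP1_outer n m u (decode_allocation ys))"
proof (cases "m = 0")
  \<comment> \<open>The input size controls \<open>n\<close> through \<open>2 * n * m\<close> only
    if there are items; without items the program stops after reading two numbers.\<close>
  case True
  have code: "instance_code n 0 num den = [int n, 0]"
    by (simp add: instance_code_def del: upt_Suc)
  have "bits (int n) \<le> input_size [int n, 0]" by (simp add: input_size_def)
  then show ?thesis
    using no_items_allocation[of n u] add unfolding True code
    by (intro wp_conseq[OF wp_program_no_items]) auto
next
  case False
  then interpret encoded_instance n m "input_size (instance_code n m num den)" num den
    using n by (intro encoded_instance_input_size) auto
  interpret encoded_utilities n m "input_size (instance_code n m num den)" num den u
    by unfold_locales (use add vals in auto)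
  have code: "instance_code n m num den =
      int n # int m # concat (map (\<lambda>j. row j 1) [1..<Suc n])"
    by (simp add: instance_code_def row_def del: upt_Suc)
  show ?thesis
  proof (rule wp_conseq[OF wp_program[folded code]])
    fix ys assume "\<exists>D. progress n m u n D ys"
    then show "length ys = m \<and> connected_allocation n m (decode_allocation ys) \<and>
        PROP1_outer n m u (decode_allocation ys)"
      using progress_final by blast
  qed
qed

theorem theorem4:
  shows "(\<forall>(n::nat) (m::nat) (u :: nat \<Rightarrow> nat set \<Rightarrow> real).
            n \<ge> 1 \<and> additive_utilities n m u \<longrightarrow>
            (\<exists>\<pi>. connected_allocation n m \<pi> \<and> PROP1_outer n m u \<pi>)) \<and>
         (\<exists>(P :: com) (p :: nat poly).
            \<forall>(n::nat) (m::nat) (u :: nat \<Rightarrow> nat set \<Rightarrow> real)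
              (num :: nat \<Rightarrow> nat \<Rightarrow> int) (den :: nat \<Rightarrow> nat \<Rightarrow> int).
              n \<ge> 1 \<and> additive_utilities n m u \<and>
              (\<forall>i\<in>{1..n}. \<forall>j\<in>{1..m}.
                 den i j > 0 \<and> u i {j} = real_of_int (num i j) / real_of_int (den i j)) \<longrightarrow>
              (\<exists>t ys. runs P (instance_code n m num den) t ys \<and>
                 t \<le> poly p (input_size (instance_code n m num den)) \<and>
                 length ys = m \<and>
                 connected_allocation n m (decode_allocation ys) \<and>
                 PROP1_outer n m u (decode_allocation ys)))"
proof (intro conjI)
  show "\<forall>(n::nat) (m::nat) (u :: nat \<Rightarrow> nat set \<Rightarrow> real).
      n \<ge> 1 \<and> additive_utilities n m u \<longrightarrow>
      (\<exists>\<pi>. connected_allocation n m \<pi> \<and> PROP1_outer n m u \<pi>)"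
    \<comment> \<open>For arbitrary real utilities the rounds give the allocation directly, without
      an encoding.\<close>
    using progress_exists[OF _ _ order_refl] progress_final(2,3) by blast
  \<comment> \<open>The polynomial depends on the program alone and is therefore the same for all
    instances.\<close>
  obtain p :: "nat poly" where p: "\<And>L. cost L program = poly p L"
    using cost_poly by blast
  have "\<exists>t ys. runs program (instance_code n m num den) t ys \<and>
      t \<le> poly p (input_size (instance_code n m num den)) \<and> length ys = m \<and>
      connected_allocation n m (decode_allocation ys) \<and> PROP1_outer n m u (decode_allocation ys)"
    if "n \<ge> 1 \<and> additive_utilities n m u \<and>
      (\<forall>i\<in>{1..n}. \<forall>j\<in>{1..m}.
         den i j > 0 \<and> u i {j} = real_of_int (num i j) / real_of_int (den i j))"
    for n m u num den
  proof -
    have "wp (input_size (instance_code n m num den)) program (\<lambda>_. 0) (instance_code n m num den) []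
        (\<lambda>s xs ys. length ys = m \<and> connected_allocation n m (decode_allocation ys) \<and>
           PROP1_outer n m u (decode_allocation ys))"
      using that by (intro program_correct) blast+
    then show ?thesis unfolding wp_def runs_def p by blast
  qed
  then show "\<exists>(P :: com) (p :: nat poly).
      \<forall>(n::nat) (m::nat) (u :: nat \<Rightarrow> nat set \<Rightarrow> real)
        (num :: nat \<Rightarrow> nat \<Rightarrow> int) (den :: nat \<Rightarrow> nat \<Rightarrow> int).
        n \<ge> 1 \<and> additive_utilities n m u \<and>
        (\<forall>i\<in>{1..n}. \<forall>j\<in>{1..m}.
           den i j > 0 \<and> u i {j} = real_of_int (num i j) / real_of_int (den i j)) \<longrightarrow>
        (\<exists>t ys. runs P (instance_code n m num den) t ys \<and>
           t \<le> poly p (input_size (instance_code n m num den)) \<and>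
           length ys = m \<and>
           connected_allocation n m (decode_allocation ys) \<and>
           PROP1_outer n m u (decode_allocation ys))"
    by (intro exI[of _ program] exI[of _ p]) blast
qed

end
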